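(* Let $p$ be a prime and let $G$ be a finite Camina $p$-group of nilpotency class $3$. Then \[ \Pr\nolimits_g(G) = \begin{cases} \frac{1}{|G|}\left(\frac{|G - \gamma_2(G)|}{|\gamma_2(G)|} + \frac{|\gamma_2(G) - \gamma_3(G)|}{|\gamma_3(G)|}\right) & \text{if } g \in \gamma_3(G),\\[4pt] \frac{1}{|G|}\cdot \frac{|G - \gamma_2(G)|}{|\gamma_2(G)|} & \text{if } g \in \gamma_2(G) - \gamma_3(G). \end{cases} \] Moreover, $|P(G)| = 2$.
   Context: For a finite group $G$ and $g \in G$, $\Pr_g(G) = |\{(x,y)\in G\times G \mid x^{-1}y^{-1}xy = g\}|/|G|^2$. $K(G)=\{[x,y]=x^{-1}y^{-1}xy \mid x,y\in G\}$ is the set of all commutators in $G$, and $P(G) = \{\Pr_g(G) \mid 1\neq g\in K(G)\}$. $\gamma_2(G)$ is the commutator subgroup of $G$ and $\gamma_3(G)=[\gamma_2(G),G]$ is the third term of the lower central series; $A-B$ denotes set difference; $x^G$ is the conjugacy class of $x$ in $G$. A finite group $G$ is a Camina group if $x^G = x\gamma_2(G)$ for all $x \in G - \gamma_2(G)$.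
   Formalization: The first case of the formula is stated only for g ≠ 1 in γ₃(G): at g = 1 the printed formula is false for every such G, since central elements contribute an extra |γ₃(G)|/|G| to Pr_1(G). *)

theory Defs
  imports "HOL-Algebra.Algebra"
begin

definition commutator :: "('a, 'b) monoid_scheme \<Rightarrow> 'a \<Rightarrow> 'a \<Rightarrow> 'a" where
  "commutator G x y = inv\<^bsub>G\<^esub> x \<otimes>\<^bsub>G\<^esub> inv\<^bsub>G\<^esub> y \<otimes>\<^bsub>G\<^esub> x \<otimes>\<^bsub>G\<^esub> y"

definition commutators :: "('a, 'b) monoid_scheme \<Rightarrow> 'a set" where
  "commutators G = {commutator G x y | x y. x \<in> carrier G \<and> y \<in> carrier G}"

definition commutator_subgroup :: "('a, 'b) monoid_scheme \<Rightarrow> 'a set \<Rightarrow> 'a set \<Rightarrow> 'a set" where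
  "commutator_subgroup G H K = generate G {commutator G h k | h k. h \<in> H \<and> k \<in> K}"

text \<open>
  Numbered as usual, \<open>\<gamma>\<^sub>1(G) = G\<close> and \<open>\<gamma>\<^sub>i\<^sub>+\<^sub>1(G) = [\<gamma>\<^sub>i(G), G]\<close>; the value at index 0 is a dummy.
\<close>

fun lower_central :: "('a, 'b) monoid_scheme \<Rightarrow> nat \<Rightarrow> 'a set" where
  "lower_central G 0 = carrier G"
| "lower_central G (Suc 0) = carrier G"
| "lower_central G (Suc (Suc n)) = commutator_subgroup G (lower_central G (Suc n)) (carrier G)"

text \<open>
  The library's \<^const>\<open>derived\<close> uses the commutators \<open>x y x\<inverse> y\<inverse>\<close>; the subgroup is the same.
\<close>

lemma (in group) lower_central_2: "lower_central G 2 = derived G (carrier G)"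
proof -
  have "{commutator G h k | h k. h \<in> carrier G \<and> k \<in> carrier G} = derived_set G (carrier G)"
    (is "?L = ?R")
  proof
    show "?L \<subseteq> ?R"
    proof
      fix z assume "z \<in> ?L"
      then obtain x y where xy: "x \<in> carrier G" "y \<in> carrier G" "z = commutator G x y" by blast
      then have "z = inv x \<otimes> inv y \<otimes> inv (inv x) \<otimes> inv (inv y)"
        by (simp add: commutator_def)
      with xy show "z \<in> ?R" using inv_closed by blast
    qed
    show "?R \<subseteq> ?L"
    proof
      fix z assume "z \<in> ?R"
      then obtain x y where xy: "x \<in> carrier G" "y \<in> carrier G"
        "z = x \<otimes> y \<otimes> inv x \<otimes> inv y" by blast
      then have "z = commutator G (inv x) (inv y)"
        by (simp add: commutator_def)
      with xy show "z \<in> ?L" using inv_closed by blast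
    qed
  qed
  then show ?thesis
    by (simp add: numeral_2_eq_2 commutator_subgroup_def derived_def)
qed

lemma lower_central_3:
  "lower_central G 3 = commutator_subgroup G (lower_central G 2) (carrier G)"
  by (simp add: numeral_3_eq_3 numeral_2_eq_2)

definition nilpotent_of_class :: "('a, 'b) monoid_scheme \<Rightarrow> nat \<Rightarrow> bool" where
  "nilpotent_of_class G c \<longleftrightarrow>
     lower_central G (c + 1) = {\<one>\<^bsub>G\<^esub>} \<and> (\<forall>d<c. lower_central G (d + 1) \<noteq> {\<one>\<^bsub>G\<^esub>})"

definition finite_p_group :: "nat \<Rightarrow> ('a, 'b) monoid_scheme \<Rightarrow> bool" where
  "finite_p_group p G \<longleftrightarrow> group G \<and> finite (carrier G) \<and> (\<exists>n. order G = p ^ n)"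

definition conjugacy_class :: "('a, 'b) monoid_scheme \<Rightarrow> 'a \<Rightarrow> 'a set" where
  "conjugacy_class G x = {inv\<^bsub>G\<^esub> y \<otimes>\<^bsub>G\<^esub> x \<otimes>\<^bsub>G\<^esub> y | y. y \<in> carrier G}"

definition camina_group :: "('a, 'b) monoid_scheme \<Rightarrow> bool" where
  "camina_group G \<longleftrightarrow> group G \<and> finite (carrier G) \<and>
     (\<forall>x \<in> carrier G - lower_central G 2. conjugacy_class G x = x <#\<^bsub>G\<^esub> lower_central G 2)"

definition commutator_prob :: "('a, 'b) monoid_scheme \<Rightarrow> 'a \<Rightarrow> real" where
  "commutator_prob G g =
     real (card {(x, y). x \<in> carrier G \<and> y \<in> carrier G \<and> commutator G x y = g})
       / real (order G) ^ 2"

definition commutator_probs :: "('a, 'b) monoid_scheme \<Rightarrow> real set" where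
  "commutator_probs G = {commutator_prob G g | g. g \<in> commutators G \<and> g \<noteq> \<one>\<^bsub>G\<^esub>}"

end

theory Submission
  imports "Jordan_Normal_Form.Determinant" "HOL-Number_Theory.Number_Theory" Defs
begin

text \<open>
  For fixed \<open>x\<close> the nonempty fibres of \<open>y \<mapsto> [x, y]\<close> are cosets of the centralizer of \<open>x\<close>, so everything
  follows once \<open>[x, G]\<close> is known: it is \<open>\<gamma>\<^sub>2\<close> for \<open>x\<close> outside \<open>\<gamma>\<^sub>2\<close> (the Camina condition), \<open>1\<close> for
  \<open>x \<in> \<gamma>\<^sub>3\<close>, and the point is that it is all of \<open>\<gamma>\<^sub>3\<close> for \<open>x \<in> \<gamma>\<^sub>2 - \<gamma>\<^sub>3\<close>.

  All factors of the lower central series are elementary abelian. Write \<open>|G : \<gamma>\<^sub>2| = p\<^sup>m\<close> and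
  \<open>|\<gamma>\<^sub>2 : \<gamma>\<^sub>3| = p\<^sup>n\<close>. Every nonzero functional on \<open>\<gamma>\<^sub>2/\<gamma>\<^sub>3\<close> turns the commutator into a nondegenerate
  alternating form on \<open>G/\<gamma>\<^sub>2\<close>, and an \<open>n\<close>-dimensional space of such forms has \<open>2n \<le> m\<close>. For odd \<open>p\<close>
  this is the argument of Chevalley and Warning for \<open>det\<^bsup>(p-1)/2\<^esup>\<close>, determinants of alternating matrices
  being squares; for \<open>p = 2\<close> it follows from the values \<open>\<plusminus>2\<^bsup>m/2\<^esup>\<close> of quadratic Gauss sums.

  If \<open>[w, G] \<noteq> \<gamma>\<^sub>3\<close> for some \<open>w \<in> \<gamma>\<^sub>2 - \<gamma>\<^sub>3\<close>, take a nonzero functional \<open>\<zeta>\<close> on \<open>\<gamma>\<^sub>3\<close> that kills \<open>[w, G]\<close>, and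
  let \<open>U \<le> \<gamma>\<^sub>2\<close> and \<open>D \<le> G\<close> be the radicals of the pairing \<open>\<zeta>[u, y]\<close>. Then \<open>|G : D| \<le> |\<gamma>\<^sub>2 : U|\<close> and
  \<open>[D, D] \<le> U\<close>, so \<open>D/\<gamma>\<^sub>2\<close> is isotropic for a form as above and \<open>|D : \<gamma>\<^sub>2| \<le> |G : D|\<close>. Hence
  \<open>p\<^sup>m \<le> |\<gamma>\<^sub>2 : U|\<^sup>2 < p\<^sup>2\<^sup>n\<close>, a contradiction.
\<close>

section \<open>Determinants of alternating matrices\<close>

text \<open>The zero diagonal is required separately, since antisymmetry does not force it in
  characteristic 2.\<close>

definition alternating_mat :: "nat \<Rightarrow> 'a :: ring_1 mat \<Rightarrow> bool" where
  "alternating_mat n A \<longleftrightarrow> A \<in> carrier_mat n n \<and> (\<forall>i<n. A $$ (i, i) = 0) \<and>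
     (\<forall>i<n. \<forall>j<n. A $$ (j, i) = - A $$ (i, j))"

text \<open>Block elimination of the leading 2 by 2 block \<open>J\<close>, whose determinant is the
  square of its upper right entry. What remains is the Schur complement; its correction term is
  antisymmetric in \<open>i\<close> and \<open>j\<close>, so it is alternating again.\<close>

lemma det_schur_alternating:
  fixes A :: "'a :: field mat"
  assumes A: "alternating_mat (2 + m) A" and c: "A $$ (0, 1) \<noteq> 0"
  shows "\<exists>S. alternating_mat m S \<and> det A = (A $$ (0, 1))\<^sup>2 * det S"
proof -
  let ?c = "A $$ (0, 1)"
  let ?r = "\<lambda>i. A $$ (i + 2, 0)" and ?s = "\<lambda>i. A $$ (i + 2, 1)"
  define J where "J = mat 2 2 (\<lambda>(i, j). A $$ (i, j))"
  define A2 where "A2 = mat 2 m (\<lambda>(i, j). A $$ (i, j + 2))"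
  \<comment> \<open>\<open>L\<close> is the lower left block of \<open>A\<close> times the inverse
    of \<open>J\<close>, so that \<open>P * Q\<close> is a block LU factorization of
    \<open>A\<close>.\<close>
  define L where "L = mat m 2 (\<lambda>(i, j). if j = 0 then ?s i / ?c else - ?r i / ?c)"
  define S where "S = mat m m (\<lambda>(i, j). A $$ (i + 2, j + 2) + (?s i * ?r j - ?r i * ?s j) / ?c)"
  have anti: "A $$ (j, i) = - A $$ (i, j)" if "i < 2 + m" "j < 2 + m" for i j
    using A that unfolding alternating_mat_def by blast
  have diag: "A $$ (i, i) = 0" if "i < 2 + m" for i
    using A that by (auto simp: alternating_mat_def)
  have dim: "A \<in> carrier_mat (2 + m) (2 + m)" using A by (simp add: alternating_mat_def)
  have carr: "J \<in> carrier_mat 2 2" "A2 \<in> carrier_mat 2 m" "L \<in> carrier_mat m 2" "S \<in> carrier_mat m m"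
    by (auto simp: J_def A2_def L_def S_def)
  have S: "alternating_mat m S"
    unfolding alternating_mat_def
  proof (intro conjI allI impI)
    fix i j assume ij: "i < m" "j < m"
    have "A $$ (j + 2, i + 2) = - A $$ (i + 2, j + 2)" using ij by (intro anti) auto
    moreover have "?s j * ?r i - ?r j * ?s i = - (?s i * ?r j - ?r i * ?s j)" by (simp add: algebra_simps)
    ultimately show "S $$ (j, i) = - S $$ (i, j)"
      using ij by (simp only: S_def index_mat split) (simp add: minus_divide_left)
  qed (auto simp: S_def diag)
  have LJ: "L * J = mat m 2 (\<lambda>(i, j). A $$ (i + 2, j))"
  proof (rule eq_matI)
    fix i j assume "i < dim_row (mat m 2 (\<lambda>(i, j). A $$ (i + 2, j)))"
      "j < dim_col (mat m 2 (\<lambda>(i, j). A $$ (i + 2, j)))"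
    then have ij: "i < m" "j < 2" by auto
    have "A $$ (Suc 0, 0) = - ?c" "A $$ (0, 0) = 0" "A $$ (Suc 0, Suc 0) = 0"
      using anti[of 0 1] by (simp_all add: diag)
    with ij c show "(L * J) $$ (i, j) = mat m 2 (\<lambda>(i, j). A $$ (i + 2, j)) $$ (i, j)"
      by (auto simp: L_def J_def scalar_prod_def numeral_2_eq_2 less_Suc_eq diag)
  qed (use carr in auto)
  have LA: "L * A2 + S = mat m m (\<lambda>(i, j). A $$ (i + 2, j + 2))"
  proof (rule eq_matI)
    fix i j assume "i < dim_row (mat m m (\<lambda>(i, j). A $$ (i + 2, j + 2)))"
      "j < dim_col (mat m m (\<lambda>(i, j). A $$ (i + 2, j + 2)))"
    then have ij: "i < m" "j < m" by auto
    have "A $$ (0, j + 2) = - ?r j" "A $$ (1, j + 2) = - ?s j"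
      using ij by (auto intro!: anti)
    with ij c show "(L * A2 + S) $$ (i, j) = mat m m (\<lambda>(i, j). A $$ (i + 2, j + 2)) $$ (i, j)"
      by (auto simp: L_def A2_def S_def scalar_prod_def numeral_2_eq_2 field_simps)
  qed (use carr in auto)
  define P where "P = four_block_mat (1\<^sub>m 2) (0\<^sub>m 2 m) L (1\<^sub>m m)"
  define Q where "Q = four_block_mat J A2 (0\<^sub>m m 2) S"
  have carr2: "P \<in> carrier_mat (2 + m) (2 + m)" "Q \<in> carrier_mat (2 + m) (2 + m)"
    using carr by (auto simp: P_def Q_def)
  have "P * Q = four_block_mat (1\<^sub>m 2 * J + 0\<^sub>m 2 m * 0\<^sub>m m 2) (1\<^sub>m 2 * A2 + 0\<^sub>m 2 m * S)
      (L * J + 1\<^sub>m m * 0\<^sub>m m 2) (L * A2 + 1\<^sub>m m * S)"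
    unfolding P_def Q_def by (rule mult_four_block_mat) (use carr in auto)
  also have "\<dots> = four_block_mat J A2 (L * J) (L * A2 + S)"
    using carr by simp
  also have "\<dots> = A"
  proof -
    have "Suc (Suc (i - 2)) = i" if "\<not> i < 2" for i using that by arith
    then show ?thesis
      unfolding LJ LA by (intro eq_matI) (use dim in \<open>auto simp: J_def A2_def\<close>)
  qed
  finally have "det A = det P * det Q"
    using det_mult[OF carr2] by simp
  moreover have "det P = 1"
    unfolding P_def using carr
    by (subst det_four_block_mat_upper_right_zero[where n = 2 and m = m]) (auto simp: det_one)
  moreover have "det Q = det J * det S"
    unfolding Q_def by (rule det_four_block_mat_lower_left_zero[where n = 2 and m = m]) (use carr in auto)
  moreover have "det J = ?c\<^sup>2"
  proof -
    have "A $$ (Suc 0, 0) = - ?c" using anti[of 0 1] by simp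
    moreover have "det J = J $$ (0,0) * J $$ (1,1) - J $$ (0,1) * J $$ (1,0)"
      using carr(1)
      by (subst laplace_expansion_row[of J 2 0])
        (auto simp: cofactor_def numeral_2_eq_2 det_single mat_delete_def)
    ultimately show ?thesis by (simp add: J_def diag power2_eq_square)
  qed
  ultimately show ?thesis using S by auto
qed

text \<open>Induction that removes two rows and columns at a time by a Schur complement. If the
  first row vanishes, the determinant is 0; in dimension 0 it is 1.\<close>

lemma det_alternating_square:
  fixes A :: "'a :: field mat"
  assumes "alternating_mat n A"
  shows "\<exists>s. det A = s\<^sup>2"
  using assms
proof (induction n arbitrary: A rule: less_induct)
  case (less n)
  note A = less.prems
  have dim: "A \<in> carrier_mat n n"
    and diag: "\<And>i. i < n \<Longrightarrow> A $$ (i, i) = 0"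
    and anti: "\<And>i j. i < n \<Longrightarrow> j < n \<Longrightarrow> A $$ (j, i) = - A $$ (i, j)"
    using A unfolding alternating_mat_def by blast+
  show ?case
  proof (cases "\<exists>j<n. A $$ (0, j) \<noteq> 0")
    case False
    show ?thesis
    proof (cases "n = 0")
      case True
      then have "det A = 1\<^sup>2" using dim by (simp add: det_dim_zero)
      then show ?thesis by blast
    next
      case n: False
      have "det A = 0"
        using False n by (subst laplace_expansion_row[OF dim, of 0]) auto
      then show ?thesis by (intro exI[of _ 0]) simp
    qed
  next
    case True
    then obtain j where j: "j < n" "A $$ (0, j) \<noteq> 0" by blast
    with diag have "j \<noteq> 0" by (metis)
    \<comment> \<open>The same transposition acts on rows and on columns. This keeps the matrix
      alternating and multiplies the determinant by the square of a sign.\<close>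
    define \<pi> where "\<pi> = Transposition.transpose 1 j"
    have \<pi>: "\<pi> permutes {0..<n}" unfolding \<pi>_def
      using j \<open>j \<noteq> 0\<close> by (intro permutes_swap_id) auto
    have \<pi>n: "\<pi> i < n" if "i < n" for i using permutes_in_image[OF \<pi>, of i] that by simp
    define R where "R = mat n n (\<lambda>(i, k). A $$ (\<pi> i, k))"
    define C where "C = mat n n (\<lambda>(i, k). R $$ (i, \<pi> k))"
    have dR: "det R = of_int (sign \<pi>) * det A"
      unfolding R_def by (rule det_permute_rows[OF dim \<pi>])
    have "transpose_mat C = mat n n (\<lambda>(i, k). transpose_mat R $$ (\<pi> i, k))"
      by (rule eq_matI) (auto simp: C_def R_def \<pi>n)
    then have "det (transpose_mat C) = of_int (sign \<pi>) * det (transpose_mat R)"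
      by (simp add: det_permute_rows[OF _ \<pi>] R_def)
    then have "det C = of_int (sign \<pi>) * det R"
      using det_transpose[of C n] det_transpose[of R n] by (simp add: C_def R_def)
    with dR have det: "det C = det A" by (simp add: sign_def)
    have C: "C $$ (i, k) = A $$ (\<pi> i, \<pi> k)" if "i < n" "k < n" for i k
      using that by (simp add: C_def R_def \<pi>n)
    have altC: "alternating_mat n C"
      unfolding alternating_mat_def
    proof (intro conjI allI impI)
      fix i k assume ik: "i < n" "k < n"
      show "C $$ (k, i) = - C $$ (i, k)"
        unfolding C[OF ik] C[OF ik(2,1)] by (rule anti) (use ik \<pi>n in auto)
    qed (auto simp: C diag \<pi>n, simp add: C_def)
    from j \<open>j \<noteq> 0\<close> have "2 \<le> n" by simp
    then obtain m where m: "n = 2 + m" using le_Suc_ex by blast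
    have "C $$ (0, 1) \<noteq> 0"
      using j \<open>j \<noteq> 0\<close> m by (subst C) (auto simp: \<pi>_def Transposition.transpose_def)
    then obtain S where S: "alternating_mat m S" "det C = (C $$ (0, 1))\<^sup>2 * det S"
      using det_schur_alternating altC m by blast
    from less.IH[OF _ S(1)] m obtain s where "det S = s\<^sup>2" by auto
    with S det have "det A = (C $$ (0, 1) * s)\<^sup>2" by (simp add: power_mult_distrib)
    then show ?thesis by blast
  qed
qed

text \<open>The determinant is a square over the rationals, and an integer that is a rational square
  is the square of an integer.\<close>

lemma det_alternating_int_square:
  fixes A :: "int mat"
  assumes A: "alternating_mat n A"
  shows "\<exists>s. det A = s\<^sup>2"
proof -
  have dim: "A \<in> carrier_mat n n" using A by (simp add: alternating_mat_def)
  let ?R = "map_mat rat_of_int A"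
  have "alternating_mat n ?R"
    unfolding alternating_mat_def
  proof (intro conjI allI impI)
    show "?R \<in> carrier_mat n n" using dim by simp
    fix i assume "i < n"
    then show "?R $$ (i, i) = 0" using A dim by (simp add: alternating_mat_def)
    fix j assume "j < n"
    have "A $$ (j, i) = - A $$ (i, j)"
      using A \<open>i < n\<close> \<open>j < n\<close> unfolding alternating_mat_def by blast
    then show "?R $$ (j, i) = - ?R $$ (i, j)" using dim \<open>i < n\<close> \<open>j < n\<close> by simp
  qed
  then obtain r where "det ?R = r\<^sup>2" using det_alternating_square by blast
  then have r: "rat_of_int (det A) = r\<^sup>2" by (simp add: of_int_hom.hom_det)
  obtain a b where ab: "r = Rat.Fract a b" "b > 0" "coprime a b" by (cases r)
  have "of_int (det A * b\<^sup>2) = (of_int (a\<^sup>2) :: rat)"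
    using r ab by (simp add: Fract_of_int_quotient power_divide field_simps)
  then have e: "det A * b\<^sup>2 = a\<^sup>2" by (simp only: of_int_eq_iff)
  then have "b\<^sup>2 dvd a\<^sup>2" by (metis dvd_triv_right)
  moreover have "coprime (a\<^sup>2) (b\<^sup>2)" using ab by simp
  ultimately have "is_unit (b\<^sup>2)" by (metis coprime_common_divisor dvd_refl)
  then have "b\<^sup>2 = 1" using zdvd1_eq[of "b\<^sup>2"] by simp
  with e show ?thesis by auto
qed

section \<open>Pencils of alternating forms over a prime field\<close>

text \<open>Telescoping \<open>p ^ Suc e\<close> and expanding binomially expresses
  \<open>Suc e\<close> times the sum through lower power sums, which are divisible by induction. As
  \<open>Suc e\<close> is less than \<open>p\<close>, it can be cancelled.\<close>

lemma prime_dvd_power_sum: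
  assumes p: "Factorial_Ring.prime p" and "e < p - 1"
  shows "int p dvd (\<Sum>a<p. int a ^ e)"
  using \<open>e < p - 1\<close>
proof (induction e rule: less_induct)
  case (less e)
  have "int p ^ Suc e = (\<Sum>a<p. int (Suc a) ^ Suc e - int a ^ Suc e)"
    by (subst sum_lessThan_telescope) simp
  also have "\<dots> = (\<Sum>a<p. \<Sum>j\<le>e. of_nat (Suc e choose j) * int a ^ j)"
  proof (rule sum.cong[OF refl])
    fix a
    have "int (Suc a) ^ Suc e = (int a + 1) ^ Suc e" by (simp add: add.commute)
    also have "\<dots> = (\<Sum>j\<le>Suc e. of_nat (Suc e choose j) * int a ^ j)"
      by (subst binomial_ring) simp
    finally show "int (Suc a) ^ Suc e - int a ^ Suc e = (\<Sum>j\<le>e. of_nat (Suc e choose j) * int a ^ j)"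
      by simp
  qed
  also have "\<dots> = (\<Sum>j\<le>e. of_nat (Suc e choose j) * (\<Sum>a<p. int a ^ j))"
    by (subst sum.swap) (simp add: sum_distrib_left)
  also have "\<dots> = (\<Sum>j<e. of_nat (Suc e choose j) * (\<Sum>a<p. int a ^ j)) + int (Suc e) * (\<Sum>a<p. int a ^ e)"
    by (simp add: lessThan_Suc_atMost[symmetric] del: of_nat_Suc)
  finally have eq: "int (Suc e) * (\<Sum>a<p. int a ^ e) =
      int p ^ Suc e - (\<Sum>j<e. of_nat (Suc e choose j) * (\<Sum>a<p. int a ^ j))" by simp
  have "int p dvd int (Suc e) * (\<Sum>a<p. int a ^ e)"
    unfolding eq by (intro dvd_diff dvd_sum dvd_mult less.IH) (use less.prems in auto)
  moreover have "\<not> int p dvd int (Suc e)"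
    using less.prems nat_dvd_not_less[of "Suc e" p] by (simp only: int_dvd_int_iff) auto
  ultimately show ?case
    using p prime_dvd_mult_iff[of "int p"] prime_nat_int_transfer by blast
qed

text \<open>Integer polynomial functions of total degree at most \<open>d\<close> in the first
  \<open>n\<close> coordinates. Generating them from monomials turns degree bounds and sums over a
  box into inductions.\<close>

inductive poly_fun :: "nat \<Rightarrow> nat \<Rightarrow> ((nat \<Rightarrow> int) \<Rightarrow> int) \<Rightarrow> bool" for n d where
  monom: "(\<Sum>k<n. e k) \<le> d \<Longrightarrow> poly_fun n d (\<lambda>\<phi>. c * (\<Prod>k<n. \<phi> k ^ e k))"
| add: "poly_fun n d f \<Longrightarrow> poly_fun n d g \<Longrightarrow> poly_fun n d (\<lambda>\<phi>. f \<phi> + g \<phi>)"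

lemma poly_fun_const: "poly_fun n d (\<lambda>\<phi>. c)"
  using poly_fun.monom[where n = n and e = "\<lambda>_. 0" and c = c] by simp

lemma poly_fun_coordinate: "k < n \<Longrightarrow> poly_fun n 1 (\<lambda>\<phi>. \<phi> k * c)"
  using poly_fun.monom[where n = n and e = "\<lambda>i. if i = k then 1 else 0" and d = 1 and c = c]
  by (simp add: if_distrib[of "\<lambda>x. _ ^ x"] mult.commute cong: if_cong)

lemma poly_fun_sum:
  "(\<And>i. i \<in> A \<Longrightarrow> poly_fun n d (f i)) \<Longrightarrow> poly_fun n d (\<lambda>\<phi>. \<Sum>i\<in>A. f i \<phi>)"
  by (induction A rule: infinite_finite_induct) (auto intro: poly_fun_const poly_fun.add)

lemma poly_fun_mult:
  assumes "poly_fun n d f" "poly_fun n d' g"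
  shows "poly_fun n (d + d') (\<lambda>\<phi>. f \<phi> * g \<phi>)"
  using assms(1)
proof induction
  case (monom e c)
  from assms(2) show ?case
  proof induction
    case (monom e' c')
    have "poly_fun n (d + d') (\<lambda>\<phi>. (c * c') * (\<Prod>k<n. \<phi> k ^ (e k + e' k)))"
      using monom \<open>sum e {..<n} \<le> d\<close> by (intro poly_fun.monom) (simp add: sum.distrib)
    then show ?case by (simp add: power_add prod.distrib mult_ac)
  next
    case (add g h)
    then show ?case by (simp add: distrib_left poly_fun.add)
  qed
next
  case (add f h)
  then show ?case by (simp add: distrib_right poly_fun.add)
qed

lemma poly_fun_prod:
  "finite A \<Longrightarrow> (\<And>i. i \<in> A \<Longrightarrow> poly_fun n (d i) (f i)) \<Longrightarrow>
    poly_fun n (\<Sum>i\<in>A. d i) (\<lambda>\<phi>. \<Prod>i\<in>A. f i \<phi>)"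
  by (induction A rule: finite_induct) (auto intro: poly_fun_const poly_fun_mult)

lemma poly_fun_power: "poly_fun n d f \<Longrightarrow> poly_fun n (d * q) (\<lambda>\<phi>. f \<phi> ^ q)"
  using poly_fun_prod[of "{..<q}" n "\<lambda>_. d" "\<lambda>_. f"] by (simp add: mult.commute)

text \<open>Warning's argument: a monomial of total degree below \<open>n (p - 1)\<close> has an exponent below
  \<open>p - 1\<close>, and the corresponding factor of its sum is a power sum divisible by \<open>p\<close>.\<close>

lemma poly_fun_sum_dvd:
  assumes p: "Factorial_Ring.prime p" and "poly_fun n d f" and d: "d < n * (p - 1)"
  shows "int p dvd (\<Sum>\<phi> \<in> {..<n} \<rightarrow>\<^sub>E int ` {..<p}. f \<phi>)"
  using assms(2)
proof induction
  case (monom e c)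
  have "\<exists>k<n. e k < p - 1"
  proof (rule ccontr)
    assume "\<not> ?thesis"
    then have "(\<Sum>k<n. p - 1) \<le> (\<Sum>k<n. e k)" by (intro sum_mono) (meson lessThan_iff not_less)
    with monom d show False by simp
  qed
  then obtain k where k: "k < n" "e k < p - 1" by blast
  have "(\<Sum>\<phi> \<in> {..<n} \<rightarrow>\<^sub>E int ` {..<p}. c * (\<Prod>k<n. \<phi> k ^ e k)) =
      c * (\<Prod>k<n. \<Sum>a\<in>int ` {..<p}. a ^ e k)"
    by (subst prod_sum_PiE) (auto simp: sum_distrib_left)
  moreover have "int p dvd (\<Sum>a\<in>int ` {..<p}. a ^ e k)"
    using prime_dvd_power_sum[OF p k(2)] by (subst sum.reindex) auto
  then have "int p dvd (\<Prod>k<n. \<Sum>a\<in>int ` {..<p}. a ^ e k)"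
    using k(1) by (meson dvd_prodI dvd_trans finite_lessThan lessThan_iff)
  ultimately show ?case by simp
next
  case (add f g)
  then show ?case by (simp add: sum.distrib)
qed

section \<open>Determinants and nondegeneracy in a pencil of forms\<close>

definition form_comb :: "nat \<Rightarrow> (nat \<Rightarrow> nat \<Rightarrow> nat \<Rightarrow> int) \<Rightarrow> (nat \<Rightarrow> int) \<Rightarrow> nat \<Rightarrow> nat \<Rightarrow> int" where
  "form_comb n B \<phi> i j = (\<Sum>k<n. \<phi> k * B k i j)"

text \<open>Each term of the Leibniz formula is a product of \<open>m\<close> entries that are
  linear in \<open>\<phi>\<close>.\<close>

lemma poly_fun_det: "poly_fun n m (\<lambda>\<phi>. det (mat m m (\<lambda>(i, j). form_comb n B \<phi> i j)))"
proof -
  have "poly_fun n (0 + (\<Sum>i\<in>{0..<m}. 1)) (\<lambda>\<phi>. signof p * (\<Prod>i = 0..<m. form_comb n B \<phi> i (p i)))" for p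
    unfolding form_comb_def
    by (intro poly_fun_mult poly_fun_const poly_fun_prod poly_fun_sum poly_fun_coordinate) auto
  then have "poly_fun n m (\<lambda>\<phi>. \<Sum>p | p permutes {0..<m}. signof p * (\<Prod>i = 0..<m. form_comb n B \<phi> i (p i)))"
    by (intro poly_fun_sum) simp
  moreover have "det (mat m m (\<lambda>(i, j). form_comb n B \<phi> i j)) =
      (\<Sum>p | p permutes {0..<m}. signof p * (\<Prod>i = 0..<m. form_comb n B \<phi> i (p i)))" for \<phi>
    by (subst det_def'[of _ m]) (auto intro!: sum.cong prod.cong)
  ultimately show ?thesis by simp
qed

lemma cong_det:
  fixes A B :: "int mat"
  assumes "A \<in> carrier_mat m m" "B \<in> carrier_mat m m"
    and "\<And>i j. i < m \<Longrightarrow> j < m \<Longrightarrow> [A $$ (i, j) = B $$ (i, j)] (mod q)"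
  shows "[det A = det B] (mod q)"
  unfolding det_def'[OF assms(1)] det_def'[OF assms(2)]
  by (intro cong_sum cong_mult cong_prod cong_refl assms(3)) auto

text \<open>The Gram matrix \<open>b\<close> has trivial left radical over the field with
  \<open>p\<close> elements; integer vectors stand for residue vectors.\<close>

definition nondegenerate_mod :: "nat \<Rightarrow> nat \<Rightarrow> (nat \<Rightarrow> nat \<Rightarrow> int) \<Rightarrow> bool" where
  "nondegenerate_mod p m b \<longleftrightarrow>
     (\<forall>a. (\<exists>i<m. \<not> int p dvd a i) \<longrightarrow> (\<exists>j<m. \<not> int p dvd (\<Sum>i<m. a i * b i j)))"

text \<open>Multiplication by \<open>b\<close> is injective on the finite set of residue vectors,
  hence surjective. Preimages of the unit vectors are the rows of a left inverse modulo
  \<open>p\<close>, so the determinant is a unit modulo \<open>p\<close>.\<close>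

lemma nondegenerate_mod_det:
  assumes p: "Factorial_Ring.prime p" and nd: "nondegenerate_mod p m b"
  shows "\<not> int p dvd det (mat m m (\<lambda>(i, j). b i j))"
proof -
  let ?V = "{..<m} \<rightarrow>\<^sub>E int ` {..<p}"
  define T where "T a = (\<lambda>j\<in>{..<m}. (\<Sum>i<m. a i * b i j) mod int p)" for a
  have p0: "p > 0" using p prime_gt_0_nat by blast
  have fin: "finite ?V" by (intro finite_PiE) auto
  have "inj_on T ?V"
  proof (rule inj_onI, rule ccontr)
    fix a a' assume a: "a \<in> ?V" "a' \<in> ?V" "T a = T a'" "a \<noteq> a'"
    then obtain i where i: "i < m" "a i \<noteq> a' i" by (metis PiE_ext lessThan_iff)
    have "a i \<in> int ` {..<p}" "a' i \<in> int ` {..<p}" using a i by auto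
    then have "\<not> int p dvd a i - a' i" using i(2)
      by (auto simp: mod_eq_dvd_iff[symmetric] simp flip: zmod_int)
    with i nd obtain j where j: "j < m" "\<not> int p dvd (\<Sum>i<m. (a i - a' i) * b i j)"
      unfolding nondegenerate_mod_def by (meson spec[of _ "\<lambda>i. a i - a' i"])
    have "T a j = T a' j" using a by simp
    with j show False
      by (simp add: T_def mod_eq_dvd_iff sum_subtractf left_diff_distrib)
  qed
  moreover have "T ` ?V \<subseteq> ?V"
  proof (intro image_subsetI PiE_I)
    fix a j assume "j \<in> {..<m}"
    then have "T a j = int (nat ((\<Sum>i<m. a i * b i j) mod int p))"
      "nat ((\<Sum>i<m. a i * b i j) mod int p) < p" using p0 by (auto simp: T_def nat_less_iff)
    then show "T a j \<in> int ` {..<p}"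
      by (intro image_eqI[of _ int "nat ((\<Sum>i<m. a i * b i j) mod int p)"]) simp_all
  qed (auto simp: T_def)
  ultimately have surj: "T ` ?V = ?V" using endo_inj_surj[OF fin] by blast
  have "\<exists>c. \<forall>j<m. [(\<Sum>i<m. c i * b i j) = (if j = l then 1 else 0)] (mod int p)" for l
  proof -
    have "(\<lambda>j\<in>{..<m}. if j = l then 1 else 0) \<in> ?V"
      using p prime_gt_1_nat[of p] by (auto intro!: image_eqI[of _ int 1] image_eqI[of _ int 0])
    then obtain c where c: "T c = (\<lambda>j\<in>{..<m}. if j = l then 1 else 0)" using surj by (metis imageE)
    show ?thesis
    proof (intro exI allI impI)
      fix j assume "j < m"
      then have "(\<Sum>i<m. c i * b i j) mod int p = (if j = l then 1 else 0)"
        using fun_cong[OF c, of j] by (simp add: T_def)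
      then show "[(\<Sum>i<m. c i * b i j) = (if j = l then 1 else 0)] (mod int p)"
        using prime_gt_1_nat[OF p] by (auto simp: cong_def)
    qed
  qed
  then have "\<forall>l. \<exists>c. \<forall>j<m. [(\<Sum>i<m. c i * b i j) = (if j = l then 1 else 0)] (mod int p)"
    by blast
  from choice[OF this] obtain c
    where c: "\<And>l j. j < m \<Longrightarrow> [(\<Sum>i<m. c l i * b i j) = (if j = l then 1 else 0)] (mod int p)"
    by blast
  let ?C = "mat m m (\<lambda>(l, i). c l i)" and ?B = "mat m m (\<lambda>(i, j). b i j)"
  have "[det (?C * ?B) = det (1\<^sub>m m)] (mod int p)"
  proof (rule cong_det)
    fix l j assume "l < m" "j < m"
    then show "[(?C * ?B) $$ (l, j) = 1\<^sub>m m $$ (l, j)] (mod int p)"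
      using c[of j l] by (auto simp: scalar_prod_def lessThan_atLeast0)
  qed auto
  then have "[det ?C * det ?B = 1] (mod int p)" by (simp add: det_mult[of _ m])
  then show ?thesis using p
    by (metis cong_dvd_iff dvd_mult not_prime_unit prime_nat_int_transfer)
qed

text \<open>These are identities between integers, not congruences, so that the determinants are
  squares of integers.\<close>

definition alternating_forms :: "nat \<Rightarrow> (nat \<Rightarrow> nat \<Rightarrow> nat \<Rightarrow> int) \<Rightarrow> bool" where
  "alternating_forms m B \<longleftrightarrow> (\<forall>k. \<forall>i<m. B k i i = 0) \<and> (\<forall>k. \<forall>i<m. \<forall>j<m. B k j i = - B k i j)"

definition nondegenerate_pencil :: "nat \<Rightarrow> nat \<Rightarrow> nat \<Rightarrow> (nat \<Rightarrow> nat \<Rightarrow> nat \<Rightarrow> int) \<Rightarrow> bool" where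
  "nondegenerate_pencil p m n B \<longleftrightarrow>
     (\<forall>\<phi>. (\<exists>k<n. \<not> int p dvd \<phi> k) \<longrightarrow> nondegenerate_mod p m (form_comb n B \<phi>))"

lemma form_comb_alternating:
  assumes "alternating_forms m B"
  shows "i < m \<Longrightarrow> form_comb n B \<phi> i i = 0"
    and "i < m \<Longrightarrow> j < m \<Longrightarrow> form_comb n B \<phi> j i = - form_comb n B \<phi> i j"
proof -
  show "i < m \<Longrightarrow> form_comb n B \<phi> i i = 0"
    using assms by (simp add: alternating_forms_def form_comb_def)
  assume "i < m" "j < m"
  then have "B k j i = - B k i j" for k using assms unfolding alternating_forms_def by blast
  then show "form_comb n B \<phi> j i = - form_comb n B \<phi> i j"
    by (simp add: form_comb_def sum_negf)
qed

lemma PiE_nonzero_coordinate: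
  assumes "\<phi> \<in> {..<n} \<rightarrow>\<^sub>E int ` {..<p}" "\<phi> \<noteq> (\<lambda>k\<in>{..<n}. 0)"
  shows "\<exists>k<n. \<not> int p dvd \<phi> k"
proof -
  obtain k where k: "k < n" "\<phi> k \<noteq> 0" using assms by (metis PiE_restrict lessThan_iff restrict_ext)
  moreover have "\<phi> k \<in> int ` {..<p}" using assms(1) k by auto
  ultimately show ?thesis using nat_dvd_not_less by fastforce
qed

text \<open>The power \<open>det\<^bsup>(p-1)/2\<^esup>\<close> has degree \<open>m (p - 1) / 2\<close> in \<open>\<phi>\<close>, and, a nondegenerate
  alternating determinant being a nonzero square, it is the indicator of \<open>\<phi> \<noteq> 0\<close>.\<close>

lemma nondegenerate_pencil_bound_odd:
  assumes p: "Factorial_Ring.prime p" "odd p" and m: "m > 0"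
    and alt: "alternating_forms m B" and nd: "nondegenerate_pencil p m n B"
  shows "2 * n \<le> m"
proof (rule ccontr)
  assume "\<not> ?thesis"
  then have n: "m < 2 * n" by simp
  obtain q where p2: "p = 2 * q + 1" using p(2) by (rule oddE)
  with prime_gt_1_nat[OF p(1)] have q: "p - 1 = 2 * q" "q > 0" by auto
  let ?V = "{..<n} \<rightarrow>\<^sub>E int ` {..<p}"
  let ?d = "\<lambda>\<phi>. det (mat m m (\<lambda>(i, j). form_comb n B \<phi> i j))"
  let ?z = "\<lambda>k\<in>{..<n}. 0 :: int"
  have fin: "finite ?V" by (intro finite_PiE) auto
  have z: "?z \<in> ?V" using prime_gt_0_nat[OF p(1)] by (auto intro!: image_eqI[of _ int 0])
  \<comment> \<open>With \<open>p - 1 = 2 * q\<close>, the assumption \<open>m < 2 * n\<close> is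
    exactly the degree condition of Warning's argument.\<close>
  have "m * q < n * (p - 1)" using n q by simp
  then have dvd: "int p dvd (\<Sum>\<phi>\<in>?V. ?d \<phi> ^ q)"
    by (rule poly_fun_sum_dvd[OF p(1) poly_fun_power[OF poly_fun_det]])
  have one: "[?d \<phi> ^ q = 1] (mod int p)" if \<phi>: "\<phi> \<in> ?V - {?z}" for \<phi>
  proof -
    have "alternating_mat m (mat m m (\<lambda>(i, j). form_comb n B \<phi> i j))"
      unfolding alternating_mat_def
    proof (intro conjI allI impI)
      fix i j assume "i < m" "j < m"
      then show "mat m m (\<lambda>(i, j). form_comb n B \<phi> i j) $$ (j, i) =
          - mat m m (\<lambda>(i, j). form_comb n B \<phi> i j) $$ (i, j)"
        using form_comb_alternating(2)[OF alt, of i j n \<phi>] by simp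
    qed (auto simp: form_comb_alternating(1)[OF alt])
    then obtain s where s: "?d \<phi> = s\<^sup>2" using det_alternating_int_square by blast
    have "\<exists>k<n. \<not> int p dvd \<phi> k" using \<phi> by (intro PiE_nonzero_coordinate) auto
    then have "nondegenerate_mod p m (form_comb n B \<phi>)"
      using nd unfolding nondegenerate_pencil_def by (elim allE[where x = \<phi>] mp)
    then have "\<not> int p dvd s\<^sup>2"
      using nondegenerate_mod_det[OF p(1)] s by metis
    then have "\<not> int p dvd s" by (metis dvd_mult power2_eq_square)
    then have "\<not> p dvd nat \<bar>s\<bar>" by simp
    then have "[nat \<bar>s\<bar> ^ (p - 1) = 1] (mod p)" by (rule fermat_theorem[OF p(1)])
    then have "[\<bar>s\<bar> ^ (p - 1) = 1] (mod int p)" by (simp add: cong_int_iff[symmetric])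
    moreover have "\<bar>s\<bar> ^ (p - 1) = ?d \<phi> ^ q"
      unfolding s q by (simp add: power_mult)
    ultimately show ?thesis by simp
  qed
  \<comment> \<open>The zero vector contributes nothing: the zero matrix has determinant 0 because
    \<open>m > 0\<close>, and \<open>q > 0\<close>.\<close>
  have "mat m m (\<lambda>(i, j). form_comb n B ?z i j) = 0\<^sub>m m m"
    by (rule eq_matI) (auto simp: form_comb_def)
  then have zero: "?d ?z ^ q = 0" using m q by simp
  \<comment> \<open>Modulo \<open>p\<close> the sum counts the nonzero vectors. Their number
    \<open>p ^ n - 1\<close> is not divisible by \<open>p\<close>, since
    \<open>n > 0\<close>.\<close>
  have "(\<Sum>\<phi>\<in>?V. ?d \<phi> ^ q) = (\<Sum>\<phi>\<in>?V - {?z}. ?d \<phi> ^ q)"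
    using zero by (simp add: sum.remove[OF fin z])
  also have "[\<dots> = (\<Sum>\<phi>\<in>?V - {?z}. 1)] (mod int p)"
    by (intro cong_sum one)
  also have "(\<Sum>\<phi>\<in>?V - {?z}. 1) = int (card ?V) - 1"
    using card_Suc_Diff1[OF fin z] by simp
  also have "card ?V = p ^ n" by (simp add: card_PiE card_image)
  finally have "int p dvd int (p ^ n) - 1" using dvd cong_dvd_iff by blast
  moreover have "int p dvd int (p ^ n)" using n by (cases n) auto
  ultimately have "int p dvd 1" by (metis dvd_diff_right_iff)
  then show False using prime_gt_1_nat[OF p(1)] by simp
qed

section \<open>Quadratic Gauss sums modulo 2\<close>

definition parity_sign :: "int \<Rightarrow> int" where
  "parity_sign z = (if even z then 1 else - 1)"

lemma parity_sign_add: "parity_sign (x + y) = parity_sign x * parity_sign y"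
  by (auto simp: parity_sign_def)

lemma parity_sign_sum: "parity_sign (\<Sum>i\<in>I. f i) = (\<Prod>i\<in>I. parity_sign (f i))"
  by (induction I rule: infinite_finite_induct) (auto simp: parity_sign_add, auto simp: parity_sign_def)

lemma parity_sign_cong: "even (x - y) \<Longrightarrow> parity_sign x = parity_sign y"
  by (auto simp: parity_sign_def)

text \<open>Orthogonality for the nontrivial character \<open>parity_sign\<close> of the integers
  modulo 2: the sum factors over coordinates, and each factor is 2 or 0.\<close>

lemma sum_parity_sign_linear:
  "(\<Sum>a \<in> {..<m} \<rightarrow>\<^sub>E int ` {..<2}. parity_sign (\<Sum>i<m. a i * t i)) =
    (if \<forall>i<m. even (t i) then 2 ^ m else 0)"
proof -
  have "(\<Sum>a \<in> {..<m} \<rightarrow>\<^sub>E int ` {..<2}. parity_sign (\<Sum>i<m. a i * t i)) =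
      (\<Prod>i<m. \<Sum>s\<in>int ` {..<2}. parity_sign (s * t i))"
    by (subst prod_sum_PiE) (auto simp: parity_sign_sum)
  also have "(\<lambda>i. \<Sum>s\<in>int ` {..<2}. parity_sign (s * t i)) = (\<lambda>i. if even (t i) then 2 else 0)"
  proof
    have "{..<2} = {0, 1 :: nat}" by auto
    then show "(\<Sum>s\<in>int ` {..<2}. parity_sign (s * t i)) = (if even (t i) then 2 else 0)" for i
      by (simp add: parity_sign_def)
  qed
  also have "(\<Prod>i<m. if even (t i) then 2 else 0) = (if \<forall>i<m. even (t i) then 2 ^ m else (0::int))"
    by (auto intro: prod_zero)
  finally show ?thesis .
qed

text \<open>A quadratic form whose polarization modulo 2 is \<open>b\<close>. It is read off the
  strict lower triangle because halving is impossible modulo 2.\<close>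

definition lower_form :: "nat \<Rightarrow> (nat \<Rightarrow> nat \<Rightarrow> int) \<Rightarrow> (nat \<Rightarrow> int) \<Rightarrow> int" where
  "lower_form m b a = (\<Sum>i<m. \<Sum>j<i. a i * a j * b i j)"

lemma even_lower_form_cong:
  assumes "\<And>i. i < m \<Longrightarrow> even (a i - c i)"
  shows "even (lower_form m b a - lower_form m b c)"
proof -
  have "even (a i * a j * b i j - c i * c j * b i j)" if "i < m" "j < i" for i j
    using assms[of i] assms[of j] that by auto
  then show ?thesis
    unfolding lower_form_def sum_subtractf[symmetric] by (intro dvd_sum) auto
qed

text \<open>Induction on the dimension: by antisymmetry the new row and column change the
  discrepancy by twice a sum.\<close>

lemma lower_form_polar:
  assumes "\<And>i. i < m \<Longrightarrow> b i i = 0" and "\<And>i j. i < m \<Longrightarrow> j < m \<Longrightarrow> b j i = - b i j"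
  shows "even (lower_form m b (\<lambda>i. a i + c i) - lower_form m b a - lower_form m b c -
    (\<Sum>i<m. a i * (\<Sum>j<m. b i j * c j)))"
  using assms
proof (induction m)
  case 0
  show ?case by (simp add: lower_form_def)
next
  case (Suc m)
  let ?D = "\<lambda>m. lower_form m b (\<lambda>i. a i + c i) - lower_form m b a - lower_form m b c -
    (\<Sum>i<m. a i * (\<Sum>j<m. b i j * c j))"
  have D: "even (?D m)" by (rule Suc.IH) (rule Suc.prems; simp)+
  have "(\<Sum>i<m. a i * b i m * c m) = - (\<Sum>i<m. a i * b m i * c m)"
    unfolding sum_negf[symmetric]
  proof (rule sum.cong[OF refl])
    fix i assume "i \<in> {..<m}"
    then have "b i m = - b m i" using Suc.prems(2)[of m i] by simp
    then show "a i * b i m * c m = - (a i * b m i * c m)" by simp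
  qed
  then have "?D (Suc m) = ?D m + 2 * (\<Sum>i<m. a i * b m i * c m)"
    using Suc.prems(1)[of m]
    by (simp add: lower_form_def algebra_simps sum.distrib sum_distrib_left sum_distrib_right)
  with D show ?case by simp
qed

text \<open>In the squared sum the second variable is translated by the first. For fixed
  \<open>c\<close> this leaves a linear character of \<open>a\<close>, whose sum is zero unless
  \<open>c\<close> lies in the radical. Only \<open>c = 0\<close> survives and contributes
  \<open>2 ^ m\<close>.\<close>

lemma gauss_sum_square:
  assumes diag: "\<And>i. i < m \<Longrightarrow> b i i = 0" and anti: "\<And>i j. i < m \<Longrightarrow> j < m \<Longrightarrow> b j i = - b i j"
    and nd: "nondegenerate_mod 2 m b"
  shows "(\<Sum>a \<in> {..<m} \<rightarrow>\<^sub>E int ` {..<2}. parity_sign (lower_form m b a))\<^sup>2 = 2 ^ m"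
proof -
  let ?V = "{..<m} \<rightarrow>\<^sub>E int ` {..<2}"
  let ?q = "lower_form m b"
  let ?z = "\<lambda>k\<in>{..<m}. 0 :: int"
  define tr where "tr a c = (\<lambda>i\<in>{..<m}. (a i + c i) mod 2)" for a c :: "nat \<Rightarrow> int"
  have bits: "int ` {..<2} = {0, 1}" by (auto simp: image_iff less_2_cases_iff)
  have fin: "finite ?V" by (intro finite_PiE) auto
  have z: "?z \<in> ?V" by (auto simp: bits)
  have trV: "tr a c \<in> ?V" for a c
    by (auto simp: tr_def bits)
  have bit: "x mod 2 = x" if "c \<in> ?V" "i < m" "x = c i" for c i x
  proof -
    have "x \<in> {0, 1}" using that PiE_mem[of c "{..<m}" "\<lambda>_. int ` {..<2}" i] by (simp add: bits)
    then show ?thesis by auto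
  qed
  have trtr: "tr a (tr a c) = c" if "c \<in> ?V" for a c
  proof (rule PiE_ext[OF trV that])
    fix i assume i: "i \<in> {..<m}"
    have "(a i + (a i + c i) mod 2) mod 2 = c i mod 2" by presburger
    with i bit[OF that, of i] show "tr a (tr a c) i = c i" by (simp add: tr_def)
  qed
  have bij: "bij_betw (tr a) ?V ?V" for a
    by (intro bij_betw_byWitness[of _ "tr a"] ballI image_subsetI trtr trV)
  \<comment> \<open>Modulo 2, polarization gives \<open>q(a) + q(a + c) = q(c) + b(a, c)\<close>:
    the terms quadratic in \<open>a\<close> cancel.\<close>
  have step: "parity_sign (?q a) * parity_sign (?q (tr a c)) =
      parity_sign (?q c) * parity_sign (\<Sum>i<m. a i * (\<Sum>j<m. b i j * c j))" for a c
  proof -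
    have "even (?q (tr a c) - ?q (\<lambda>i. a i + c i))"
    proof (rule even_lower_form_cong)
      fix i assume "i < m"
      then show "even (tr a c i - (a i + c i))" unfolding tr_def by simp
    qed
    moreover have "even (?q (\<lambda>i. a i + c i) - ?q a - ?q c - (\<Sum>i<m. a i * (\<Sum>j<m. b i j * c j)))"
      by (rule lower_form_polar) (rule diag anti; assumption)+
    ultimately have "even (?q a + ?q (tr a c) - (?q c + (\<Sum>i<m. a i * (\<Sum>j<m. b i j * c j))))"
      by presburger
    from parity_sign_cong[OF this] show ?thesis by (simp only: parity_sign_add)
  qed
  \<comment> \<open>Nondegeneracy is stated for the left radical; antisymmetry carries it over to
    the right one.\<close>
  have radical: "c = ?z" if c: "c \<in> ?V" and even: "\<forall>i<m. even (\<Sum>j<m. b i j * c j)" for c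
  proof (rule ccontr)
    assume "c \<noteq> ?z"
    with c have "\<exists>k<m. \<not> int 2 dvd c k" by (intro PiE_nonzero_coordinate) auto
    with nd obtain j where j: "j < m" "odd (\<Sum>i<m. c i * b i j)"
      unfolding nondegenerate_mod_def by (auto simp del: even_sum_iff)
    have "(\<Sum>i<m. c i * b i j) = - (\<Sum>i<m. b j i * c i)"
      unfolding sum_negf[symmetric]
    proof (rule sum.cong[OF refl])
      fix i assume "i \<in> {..<m}"
      then have "b i j = - b j i" using anti[of j i] j by simp
      then show "c i * b i j = - (b j i * c i)" by simp
    qed
    with j even show False by simp
  qed
  have "(\<Sum>a\<in>?V. parity_sign (?q a))\<^sup>2 = (\<Sum>a\<in>?V. \<Sum>c\<in>?V. parity_sign (?q a) * parity_sign (?q c))"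
    by (simp add: power2_eq_square sum_product)
  also have "\<dots> = (\<Sum>a\<in>?V. \<Sum>c\<in>?V. parity_sign (?q a) * parity_sign (?q (tr a c)))"
    by (intro sum.cong refl sum.reindex_bij_betw[OF bij, symmetric])
  also have "\<dots> = (\<Sum>c\<in>?V. \<Sum>a\<in>?V. parity_sign (?q c) * parity_sign (\<Sum>i<m. a i * (\<Sum>j<m. b i j * c j)))"
    unfolding step by (rule sum.swap)
  also have "\<dots> = (\<Sum>c\<in>?V. parity_sign (?q c) * (if \<forall>i<m. even (\<Sum>j<m. b i j * c j) then 2 ^ m else 0))"
    by (simp only: sum_distrib_left[symmetric] sum_parity_sign_linear)
  also have "\<dots> = (\<Sum>c\<in>?V. if c = ?z then 2 ^ m else 0)"
  proof (intro sum.cong refl)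
    fix c assume c: "c \<in> ?V"
    show "parity_sign (?q c) * (if \<forall>i<m. even (\<Sum>j<m. b i j * c j) then 2 ^ m else 0) =
        (if c = ?z then 2 ^ m else 0)"
    proof (cases "c = ?z")
      case True
      then have "?q c = 0" "(\<Sum>j<m. b i j * c j) = 0" for i by (auto simp: lower_form_def)
      with True show ?thesis by (simp add: parity_sign_def)
    next
      case False
      with radical[OF c] show ?thesis by auto
    qed
  qed
  also have "\<dots> = 2 ^ m" using fin z by (simp only: sum.delta' sum.delta if_True)
  finally show ?thesis .
qed

lemma lower_form_comb:
  "lower_form m (form_comb n B \<phi>) a = (\<Sum>k<n. \<phi> k * lower_form m (B k) a)"
proof -
  have "(\<Sum>k<n. \<phi> k * lower_form m (B k) a) = (\<Sum>k<n. \<Sum>i<m. \<Sum>j<i. \<phi> k * (a i * a j * B k i j))"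
    by (simp add: lower_form_def sum_distrib_left)
  also have "\<dots> = (\<Sum>i<m. \<Sum>j<i. \<Sum>k<n. \<phi> k * (a i * a j * B k i j))"
    by (simp only: sum.swap[of _ _ "{..<n}"])
  also have "\<dots> = lower_form m (form_comb n B \<phi>) a"
    by (simp add: lower_form_def form_comb_def sum_distrib_left mult_ac)
  finally show ?thesis by simp
qed

text \<open>The sum of all Gauss sums \<open>S \<phi>\<close> is computed twice. It is divisible by
  \<open>2 ^ n\<close>, and it is also \<open>2 ^ m\<close> plus an odd number of terms, each
  \<open>2 ^ h\<close> up to sign, where \<open>m = 2 * h\<close>. So it is \<open>2 ^ h\<close>
  times an odd number, whence \<open>n \<le> h\<close>.\<close>

lemma nondegenerate_pencil_bound_two:
  assumes m: "m > 0" and alt: "alternating_forms m B" and nd: "nondegenerate_pencil 2 m n B"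
  shows "2 * n \<le> m"
proof (cases "n = 0")
  case False
  let ?V = "\<lambda>n :: nat. {..<n} \<rightarrow>\<^sub>E int ` {..<2}"
  let ?z = "\<lambda>k\<in>{..<n}. 0 :: int"
  define S where "S \<phi> = (\<Sum>a\<in>?V m. parity_sign (lower_form m (form_comb n B \<phi>) a))" for \<phi>
  have fin: "finite (?V n)" for n by (intro finite_PiE) simp_all
  have cardV: "card (?V n) = 2 ^ n" for n by (simp add: card_PiE card_image)
  have z: "?z \<in> ?V n" by (auto simp: image_iff)
  have square: "(S \<phi>)\<^sup>2 = 2 ^ m" if "\<phi> \<in> ?V n - {?z}" for \<phi>
  proof -
    have "\<exists>k<n. \<not> int 2 dvd \<phi> k" using that by (intro PiE_nonzero_coordinate) auto
    then have "nondegenerate_mod 2 m (form_comb n B \<phi>)"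
      using nd unfolding nondegenerate_pencil_def by (elim allE[where x = \<phi>] mp)
    then show ?thesis
      unfolding S_def by (rule gauss_sum_square[rotated 2]) (rule form_comb_alternating[OF alt]; assumption)+
  qed
  \<comment> \<open>After the exchange the inner sum over \<open>\<phi>\<close> is a linear
    character sum, equal to \<open>2 ^ n\<close> or 0.\<close>
  have "(\<Sum>\<phi>\<in>?V n. S \<phi>) = (\<Sum>a\<in>?V m. \<Sum>\<phi>\<in>?V n. parity_sign (\<Sum>k<n. \<phi> k * lower_form m (B k) a))"
    unfolding S_def lower_form_comb by (rule sum.swap)
  then have dvd: "2 ^ n dvd (\<Sum>\<phi>\<in>?V n. S \<phi>)"
    by (simp only: sum_parity_sign_linear) (intro dvd_sum, auto)
  have "S ?z = 2 ^ m"
    unfolding S_def lower_form_comb by (simp add: parity_sign_def cardV)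
  then have sum: "(\<Sum>\<phi>\<in>?V n. S \<phi>) = 2 ^ m + (\<Sum>\<phi>\<in>?V n - {?z}. S \<phi>)"
    using sum.remove[OF fin z, of S] by simp
  have card: "int (card (?V n - {?z})) = 2 ^ n - 1"
    using z fin by (simp add: cardV of_nat_diff)
  have "?V n - {?z} \<noteq> {}"
  proof
    assume "?V n - {?z} = {}"
    with card have "(2::int) ^ n = 1" by (simp only: card.empty)
    with False show False by simp
  qed
  then obtain \<phi> where "\<phi> \<in> ?V n - {?z}" by blast
  \<comment> \<open>One nonzero \<open>\<phi>\<close> suffices to see that \<open>2 ^ m\<close> is a
    perfect square, so \<open>m\<close> is even.\<close>
  from square[OF this] have "multiplicity 2 ((S \<phi>)\<^sup>2) = multiplicity 2 ((2::int) ^ m)" by simp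
  moreover have "S \<phi> \<noteq> 0" using square[OF \<open>\<phi> \<in> _\<close>] by auto
  ultimately have "2 * multiplicity 2 (S \<phi>) = m"
    by (simp add: prime_elem_multiplicity_power_distrib)
  then obtain h where h: "m = 2 * h" by metis
  have odd: "2 ^ h dvd S \<phi> \<and> odd (S \<phi> div 2 ^ h)" if "\<phi> \<in> ?V n - {?z}" for \<phi>
  proof -
    have "(S \<phi>)\<^sup>2 = (2 ^ h)\<^sup>2" using square[OF that] h by (simp add: power_mult[symmetric] mult.commute)
    then have "S \<phi> = 2 ^ h \<or> S \<phi> = - (2 ^ h)" by (simp add: power2_eq_iff)
    then have "\<exists>e. odd e \<and> S \<phi> = 2 ^ h * e"
      by (elim disjE) (rule exI[of _ 1], simp, rule exI[of _ "- 1"], simp)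
    then obtain e where "odd e" "S \<phi> = 2 ^ h * e" by blast
    then show ?thesis by simp
  qed
  define E where "E = (\<Sum>\<phi>\<in>?V n - {?z}. S \<phi> div 2 ^ h)"
  have E: "(\<Sum>\<phi>\<in>?V n - {?z}. S \<phi>) = 2 ^ h * E"
    unfolding E_def sum_distrib_left using odd by (intro sum.cong) auto
  have "[E = (\<Sum>\<phi>\<in>?V n - {?z}. 1)] (mod 2)"
    unfolding E_def by (intro cong_sum) (use odd in \<open>auto simp: cong_def odd_iff_mod_2_eq_one\<close>)
  then have "[E = 2 ^ n - 1] (mod 2)" using card by simp
  then have "odd E" using False cong_dvd_iff[of E "2 ^ n - 1" 2] by simp
  moreover have "even ((2::int) ^ h)" using m h by simp
  ultimately have "coprime (2 ^ n) (2 ^ h + E)" by simp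
  moreover have "2 ^ n dvd 2 ^ h * (2 ^ h + E)"
    using dvd unfolding sum E h by (simp add: distrib_left power_mult power2_eq_square power_add mult_2)
  ultimately have "(2::int) ^ n dvd 2 ^ h" using coprime_dvd_mult_left_iff by blast
  then have "(2::int) ^ n \<le> 2 ^ h" by (rule zdvd_imp_le) simp
  then have "n \<le> h" by simp
  with h show ?thesis by simp
qed simp

theorem nondegenerate_pencil_bound:
  assumes "Factorial_Ring.prime p" "m > 0" "alternating_forms m B" "nondegenerate_pencil p m n B"
  shows "2 * n \<le> m"
proof (cases "p = 2")
  case True
  with assms nondegenerate_pencil_bound_two show ?thesis by simp
next
  case False
  then have "odd p" using assms(1) prime_prime_factor primes_dvd_imp_eq two_is_prime_nat by blast
  with assms nondegenerate_pencil_bound_odd show ?thesis by blast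
qed

section \<open>Functionals modulo p and elementary abelian sections\<close>

context group begin

text \<open>Elements of \<open>\<int>/p\<close> are represented by arbitrary integers, and functionals are additive only
  modulo \<open>p\<close>.\<close>

definition functional :: "nat \<Rightarrow> 'a set \<Rightarrow> ('a \<Rightarrow> int) \<Rightarrow> bool" where
  "functional p K f \<longleftrightarrow> (\<forall>g\<in>K. \<forall>h\<in>K. [f (g \<otimes> h) = f g + f h] (mod int p))"

text \<open>\<open>K / N\<close> is an elementary abelian \<open>p\<close>-group, expressed without
  forming quotients; normality of \<open>N\<close> in \<open>K\<close> is implied by the commutator
  condition.\<close>

definition elementary_pair :: "nat \<Rightarrow> 'a set \<Rightarrow> 'a set \<Rightarrow> bool" where
  "elementary_pair p K N \<longleftrightarrow> subgroup K G \<and> subgroup N G \<and> N \<subseteq> K \<and>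
     (\<forall>g\<in>K. \<forall>h\<in>K. commutator G g h \<in> N) \<and> (\<forall>g\<in>K. g [^] p \<in> N)"

lemma subgroup_nat_pow_closed:
  fixes k :: nat
  shows "subgroup K G \<Longrightarrow> g \<in> K \<Longrightarrow> g [^] k \<in> K"
  by (induction k) (auto simp: subgroup.one_closed subgroup.m_closed)

lemma inv_mult_cancel: "u \<in> carrier G \<Longrightarrow> z \<in> carrier G \<Longrightarrow> inv u \<otimes> (u \<otimes> z) = z"
  by (simp add: m_assoc[symmetric])

lemma mult_inv_cancel: "u \<in> carrier G \<Longrightarrow> z \<in> carrier G \<Longrightarrow> u \<otimes> (inv u \<otimes> z) = z"
  by (simp add: m_assoc[symmetric])

lemma functional_mult:
  "functional p K f \<Longrightarrow> g \<in> K \<Longrightarrow> h \<in> K \<Longrightarrow> [f (g \<otimes> h) = f g + f h] (mod int p)"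
  by (simp add: functional_def)

lemma functional_one:
  assumes "functional p K f" "subgroup K G"
  shows "[f \<one> = 0] (mod int p)"
proof -
  have "[f (\<one> \<otimes> \<one>) = f \<one> + f \<one>] (mod int p)"
    using functional_mult[OF assms(1)] subgroup.one_closed[OF assms(2)] by blast
  then show ?thesis by (simp add: cong_iff_dvd_diff)
qed

lemma functional_inv:
  assumes f: "functional p K f" and K: "subgroup K G" and g: "g \<in> K"
  shows "[f (inv g) = - f g] (mod int p)"
proof -
  have "[f (g \<otimes> inv g) = f g + f (inv g)] (mod int p)"
    using functional_mult[OF f g] subgroup.m_inv_closed[OF K g] by blast
  moreover have "g \<otimes> inv g = \<one>" using subgroup.mem_carrier[OF K g] by simp
  ultimately have "[f g + f (inv g) = 0] (mod int p)"
    using functional_one[OF f K] by (metis cong_sym cong_trans)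
  then show ?thesis by (simp add: cong_iff_dvd_diff add.commute)
qed

lemma functional_pow:
  fixes k :: nat
  assumes f: "functional p K f" and K: "subgroup K G" and g: "g \<in> K"
  shows "[f (g [^] k) = int k * f g] (mod int p)"
proof (induction k)
  case 0
  then show ?case using functional_one[OF f K] by simp
next
  case (Suc k)
  have "[f (g [^] k \<otimes> g) = f (g [^] k) + f g] (mod int p)"
    using functional_mult[OF f _ g] subgroup_nat_pow_closed[OF K g] by blast
  moreover have "[f (g [^] k) + f g = int k * f g + f g] (mod int p)"
    using Suc by (rule cong_add) (rule cong_refl)
  ultimately show ?case by (simp add: algebra_simps) (metis cong_trans)
qed

lemma functional_diff:
  assumes f: "functional p K f" and K: "subgroup K G" and "g \<in> K" "h \<in> K"
  shows "[f (g \<otimes> inv h) = f g - f h] (mod int p)"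
proof -
  have "[f (g \<otimes> inv h) = f g + f (inv h)] (mod int p)"
    using functional_mult[OF f] assms subgroup.m_inv_closed[OF K] by blast
  moreover have "[f g + f (inv h) = f g + - f h] (mod int p)"
    by (intro cong_add cong_refl functional_inv[OF f K]) fact
  ultimately show ?thesis by (metis cong_trans diff_conv_add_uminus)
qed

lemma functional_add:
  "functional p K f \<Longrightarrow> functional p K f' \<Longrightarrow> functional p K (\<lambda>g. f g + f' g)"
  unfolding functional_def
proof (intro ballI)
  fix g h assume *: "\<forall>g\<in>K. \<forall>h\<in>K. [f (g \<otimes> h) = f g + f h] (mod int p)"
    "\<forall>g\<in>K. \<forall>h\<in>K. [f' (g \<otimes> h) = f' g + f' h] (mod int p)" "g \<in> K" "h \<in> K"
  then have "[f (g \<otimes> h) + f' (g \<otimes> h) = (f g + f h) + (f' g + f' h)] (mod int p)"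
    by (intro cong_add) auto
  then show "[f (g \<otimes> h) + f' (g \<otimes> h) = f g + f' g + (f h + f' h)] (mod int p)"
    by (simp add: algebra_simps)
qed

lemma functional_scale: "functional p K f \<Longrightarrow> functional p K (\<lambda>g. c * f g)"
  unfolding functional_def by (metis cong_scalar_left distrib_left)

lemma functional_sum:
  "(\<And>i. i \<in> I \<Longrightarrow> functional p K (f i)) \<Longrightarrow> functional p K (\<lambda>g. \<Sum>i\<in>I. f i g)"
  by (induction I rule: infinite_finite_induct) (auto intro: functional_add simp: functional_def[of p K "\<lambda>g. 0"])

lemma functional_subset: "functional p K f \<Longrightarrow> L \<subseteq> K \<Longrightarrow> functional p L f"
  unfolding functional_def by blast

text \<open>Bezout: \<open>y\<close> is a product of powers of \<open>y [^] p\<close> and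
  \<open>y [^] i\<close>.\<close>

lemma mem_of_coprime_pow:
  fixes i :: nat
  assumes M: "subgroup M G" and y: "y \<in> carrier G" and p: "Factorial_Ring.prime p" "\<not> p dvd i"
    and yp: "y [^] p \<in> M" and yi: "y [^] i \<in> M"
  shows "y \<in> M"
proof -
  have "coprime p i" using p by (simp add: prime_imp_coprime_nat)
  then obtain u v where uv: "u * int p + v * int i = 1"
    using bezout_int[of "int p" "int i"] by (auto simp: coprime_int_iff)
  have "(y [^] p) [^] u \<otimes> (y [^] i) [^] v = y [^] (u * int p + v * int i)"
    using y by (simp add: int_pow_pow int_pow_mult int_pow_int[symmetric] mult.commute)
  also have "\<dots> = y" unfolding uv using y by (simp add: int_pow_1)
  finally show ?thesis
    using M yp yi by (metis subgroup_int_pow_closed subgroup.m_closed)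
qed

text \<open>The conjugate of \<open>h\<close> by \<open>g\<close> is the commutator of
  \<open>g\<close> and \<open>inv h\<close> times \<open>h\<close>.\<close>

lemma conj_mem_of_commutators:
  assumes M: "subgroup M G" and K: "subgroup K G" and MK: "M \<subseteq> K"
    and comm: "\<And>g h. g \<in> K \<Longrightarrow> h \<in> K \<Longrightarrow> commutator G g h \<in> M"
    and g: "g \<in> K" and h: "h \<in> M"
  shows "inv g \<otimes> h \<otimes> g \<in> M"
proof -
  have c: "g \<in> carrier G" "h \<in> carrier G" using g h subgroup.mem_carrier M K by metis+
  have "commutator G g (inv h) \<in> M" using comm g h MK subgroup.m_inv_closed[OF M] by blast
  then have "commutator G g (inv h) \<otimes> h \<in> M" using subgroup.m_closed[OF M] h by blast
  moreover have "commutator G g (inv h) \<otimes> h = inv g \<otimes> h \<otimes> g"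
    using c by (simp add: commutator_def m_assoc)
  ultimately show ?thesis by simp
qed

text \<open>Conjugation moves \<open>y [^] i\<close> past the second factor without leaving
  \<open>M\<close>. The resulting addition of exponents makes the functional built from them
  additive.\<close>

lemma mult_pow_mem_of_commutators:
  fixes i j :: nat
  assumes M: "subgroup M G" and K: "subgroup K G" and MK: "M \<subseteq> K"
    and comm: "\<And>g h. g \<in> K \<Longrightarrow> h \<in> K \<Longrightarrow> commutator G g h \<in> M"
    and yx: "y \<in> K" "g \<in> K" "h \<in> K" and mem: "g \<otimes> y [^] i \<in> M" "h \<otimes> y [^] j \<in> M"
  shows "g \<otimes> h \<otimes> y [^] (i + j) \<in> M"
proof -
  have c: "g \<in> carrier G" "h \<in> carrier G" "y \<in> carrier G"
    using yx subgroup.mem_carrier K by metis+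
  have "inv (y [^] i) \<otimes> (h \<otimes> y [^] j) \<otimes> y [^] i \<in> M"
    by (rule conj_mem_of_commutators[OF M K MK comm]) (use subgroup_nat_pow_closed[OF K] yx mem in auto)
  then have "g \<otimes> y [^] i \<otimes> (inv (y [^] i) \<otimes> (h \<otimes> y [^] j) \<otimes> y [^] i) \<in> M"
    using subgroup.m_closed[OF M] mem by blast
  moreover have "g \<otimes> y [^] i \<otimes> (inv (y [^] i) \<otimes> (h \<otimes> y [^] j) \<otimes> y [^] i) = g \<otimes> h \<otimes> y [^] (i + j)"
    using c by (simp add: m_assoc mult_inv_cancel nat_pow_mult add.commute)
  ultimately show ?thesis by simp
qed

text \<open>Take \<open>M\<close> maximal among the subgroups between \<open>N\<close> and
  \<open>K\<close> that avoid \<open>a\<close>. Then powers of \<open>a\<close> represent all cosets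
  of \<open>M\<close> in \<open>K\<close>, and the exponent modulo \<open>p\<close> is the desired
  functional.\<close>

lemma exists_functional:
  assumes fin: "finite (carrier G)" and p: "Factorial_Ring.prime p"
    and EP: "elementary_pair p K N" and a: "a \<in> K" "a \<notin> N"
  shows "\<exists>f. functional p K f \<and> (\<forall>g\<in>N. int p dvd f g) \<and> [f a = 1] (mod int p)"
proof -
  have K: "subgroup K G" and N: "subgroup N G" "N \<subseteq> K"
    and commN: "\<And>g h. g \<in> K \<Longrightarrow> h \<in> K \<Longrightarrow> commutator G g h \<in> N"
    and powN: "\<And>g. g \<in> K \<Longrightarrow> g [^] p \<in> N"
    using EP by (auto simp: elementary_pair_def)
  have Kc: "K \<subseteq> carrier G" by (rule subgroup.subset[OF K])
  let ?S = "{M. subgroup M G \<and> N \<subseteq> M \<and> M \<subseteq> K \<and> a \<notin> M}"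
  have "finite ?S" by (rule finite_subset[of _ "Pow (carrier G)"]) (use Kc fin in auto)
  moreover have "N \<in> ?S" using N a by auto
  ultimately obtain M where "M \<in> ?S" and max: "\<And>L. L \<in> ?S \<Longrightarrow> M \<subseteq> L \<Longrightarrow> M = L"
    using finite_has_maximal[of ?S] by (metis (no_types, lifting) empty_iff)
  then have M: "subgroup M G" "N \<subseteq> M" "M \<subseteq> K" "a \<notin> M" by auto
  have comm: "commutator G g h \<in> M" if "g \<in> K" "h \<in> K" for g h using commN[OF that] M by blast
  have pow: "g [^] p \<in> M" if "g \<in> K" for g using powN[OF that] M by blast
  have shift: "g \<otimes> h \<otimes> y [^] (i + j) \<in> M"
    if "y \<in> K" "g \<in> K" "h \<in> K" "g \<otimes> y [^] i \<in> M" "h \<otimes> y [^] j \<in> M" for y g h and i j :: nat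
    by (rule mult_pow_mem_of_commutators[OF M(1) K M(3) comm]) (use that in auto)
  have p1: "p > 0" using prime_gt_0_nat[OF p] .
  \<comment> \<open>Adjoining \<open>y\<close> to \<open>M\<close> adds only multiples of powers of
    \<open>y\<close>. Natural exponents suffice, \<open>p - 1\<close> playing the role of
    \<open>-1\<close>.\<close>
  have gen: "\<exists>i::nat. x \<otimes> y [^] i \<in> M" if y: "y \<in> K" and "x \<in> generate G (insert y M)" for x y
  proof -
    have incl: "generate G (insert y M) \<subseteq> K"
      by (rule generate_subgroup_incl) (use y M K in auto)
    have yc: "y \<in> carrier G" using y Kc by blast
    from that(2) show ?thesis
    proof induction
      case one
      then show ?case using subgroup.one_closed[OF M(1)] by (intro exI[of _ 0]) simp
    next
      case (incl h)
      show ?case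
      proof (cases "h = y")
        case True
        have "y \<otimes> y [^] (p - 1) = y [^] (1 + (p - 1))"
          using yc by (subst nat_pow_mult[symmetric]) auto
        then have "y \<otimes> y [^] (p - 1) \<in> M" using pow[OF y] p1 by simp
        with True show ?thesis by blast
      next
        case False
        with incl M Kc show ?thesis by (intro exI[of _ 0]) auto
      qed
    next
      case (inv h)
      show ?case
      proof (cases "h = y")
        case True
        then show ?thesis using yc subgroup.one_closed[OF M(1)] by (intro exI[of _ 1]) simp
      next
        case False
        then have "inv h \<in> M" using inv subgroup.m_inv_closed[OF M(1)] by blast
        with M Kc show ?thesis by (intro exI[of _ 0]) auto
      qed
    next
      case (eng g h)
      then obtain i j :: nat where "g \<otimes> y [^] i \<in> M" "h \<otimes> y [^] j \<in> M" by blast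
      moreover have "g \<in> K" "h \<in> K" using eng incl by auto
      ultimately show ?case using shift[OF y] by blast
    qed
  qed
  \<comment> \<open>Otherwise adjoining \<open>x\<close> to \<open>M\<close> captures
    \<open>a\<close> by maximality, so \<open>a \<otimes> x [^] i\<close> is in \<open>M\<close>
    with \<open>i\<close> prime to \<open>p\<close>. Bezout then puts \<open>x\<close> into the
    subgroup generated by \<open>a\<close> and \<open>M\<close>.\<close>
  have all: "\<exists>i::nat. x \<otimes> a [^] i \<in> M" if x: "x \<in> K" for x
  proof (rule ccontr)
    assume no: "\<not> ?thesis"
    let ?A = "generate G (insert a M)" and ?X = "generate G (insert x M)"
    have sub: "insert a M \<subseteq> carrier G" "insert x M \<subseteq> carrier G" using a x M Kc by auto
    have A: "subgroup ?A G" and X: "subgroup ?X G" using generate_is_subgroup sub by blast+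
    have MA: "M \<subseteq> ?A" "a \<in> ?A" by (auto intro: generate.incl)
    have "x \<notin> ?A" using gen[OF a(1)] no by blast
    then have "x \<notin> M" using MA by blast
    have MX: "M \<subseteq> ?X" "x \<in> ?X" by (auto intro: generate.incl)
    have "?X \<subseteq> K" by (rule generate_subgroup_incl) (use x M K in auto)
    have "a \<in> ?X"
    proof (rule ccontr)
      assume "a \<notin> ?X"
      then have "?X \<in> ?S" using X MX M \<open>?X \<subseteq> K\<close> by auto
      with max MX \<open>x \<notin> M\<close> show False by blast
    qed
    from gen[OF x this] obtain i :: nat where i: "a \<otimes> x [^] i \<in> M" by blast
    have xc: "x \<in> carrier G" "a \<in> carrier G" using x a Kc by auto
    have "\<not> p dvd i"
    proof
      assume "p dvd i"
      then obtain k where "i = p * k" by blast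
      then have "x [^] i = (x [^] p) [^] k" using xc by (simp add: nat_pow_pow)
      then have "x [^] i \<in> M" using pow[OF x] subgroup_nat_pow_closed[OF M(1)] by metis
      with i have "a \<otimes> x [^] i \<otimes> inv (x [^] i) \<in> M"
        using subgroup.m_closed[OF M(1)] subgroup.m_inv_closed[OF M(1)] by blast
      then show False using M(4) xc by (simp add: m_assoc)
    qed
    have "inv a \<otimes> (a \<otimes> x [^] i) \<in> ?A"
      using i MA subgroup.m_closed[OF A] subgroup.m_inv_closed[OF A] by blast
    then have "x [^] i \<in> ?A" using xc by (simp add: m_assoc[symmetric])
    moreover have "x [^] p \<in> ?A" using pow[OF x] MA by blast
    ultimately show False
      using mem_of_coprime_pow[OF A xc(1) p \<open>\<not> p dvd i\<close>] \<open>x \<notin> ?A\<close> by blast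
  qed
  define e where "e x = (SOME i::nat. x \<otimes> a [^] i \<in> M)" for x
  have e: "x \<otimes> a [^] e x \<in> M" if "x \<in> K" for x
    using someI_ex[OF all[OF that]] by (simp add: e_def)
  have ac: "a \<in> carrier G" using a Kc by blast
  \<comment> \<open>Two exponents that differ modulo \<open>p\<close> would put a power of
    \<open>a\<close> prime to \<open>p\<close> into \<open>M\<close>, and hence \<open>a\<close>
    itself.\<close>
  have uniq: "[int i = int j] (mod int p)"
    if "x \<in> K" "x \<otimes> a [^] i \<in> M" "x \<otimes> a [^] j \<in> M" "i \<le> j" for x and i j :: nat
  proof (rule ccontr)
    assume "\<not> ?thesis"
    then have "\<not> p dvd j - i" using that(4)
      by (metis cong_iff_dvd_diff cong_sym int_dvd_int_iff of_nat_diff)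
    have xc: "x \<in> carrier G" using that Kc by blast
    have "inv (x \<otimes> a [^] i) \<otimes> (x \<otimes> a [^] j) \<in> M"
      using that subgroup.m_closed[OF M(1)] subgroup.m_inv_closed[OF M(1)] by blast
    moreover have "x \<otimes> a [^] j = x \<otimes> a [^] i \<otimes> a [^] (j - i)"
      using xc ac that(4) by (simp add: m_assoc nat_pow_mult)
    then have "inv (x \<otimes> a [^] i) \<otimes> (x \<otimes> a [^] j) = a [^] (j - i)"
      using xc ac inv_mult_cancel[of "x \<otimes> a [^] i" "a [^] (j - i)"] by simp
    ultimately show False
      using mem_of_coprime_pow[OF M(1) ac p \<open>\<not> p dvd j - i\<close> pow[OF a(1)]] M(4) by simp
  qed
  have uniq': "[int i = int j] (mod int p)"
    if "x \<in> K" "x \<otimes> a [^] i \<in> M" "x \<otimes> a [^] j \<in> M" for x and i j :: nat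
    using uniq[OF that] uniq[OF that(1,3,2)] cong_sym linear by blast
  \<comment> \<open>The sign is needed because \<open>x \<otimes> a [^] e x\<close> in
    \<open>M\<close> means that \<open>x\<close> behaves like the power of \<open>a\<close> with
    exponent \<open>- e x\<close>.\<close>
  define f where "f x = - int (e x)" for x
  have "functional p K f"
    unfolding functional_def
  proof (intro ballI)
    fix g h assume gh: "g \<in> K" "h \<in> K"
    then have ghK: "g \<otimes> h \<in> K" using subgroup.m_closed[OF K] by blast
    have "[int (e (g \<otimes> h)) = int (e g + e h)] (mod int p)"
      by (rule uniq'[OF ghK e[OF ghK] shift[OF a(1) gh e[OF gh(1)] e[OF gh(2)]]])
    then have "[- int (e (g \<otimes> h)) = - int (e g + e h)] (mod int p)" by (simp only: cong_minus_minus_iff)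
    then show "[f (g \<otimes> h) = f g + f h] (mod int p)" by (simp add: f_def)
  qed
  moreover have "int p dvd f g" if "g \<in> N" for g
  proof -
    have gK: "g \<in> K" using that N by blast
    have "g \<in> M" using that M by blast
    then have "g \<otimes> a [^] (0 :: nat) \<in> M" using gK Kc by auto
    then have "[int (e g) = int 0] (mod int p)" by (rule uniq'[OF gK e[OF gK]])
    then show ?thesis by (simp add: f_def cong_0_iff)
  qed
  moreover have "[f a = 1] (mod int p)"
  proof -
    have "a \<otimes> a [^] (p - 1) = a [^] (1 + (p - 1))" using ac by (subst nat_pow_mult[symmetric]) auto
    then have "a \<otimes> a [^] (p - 1) \<in> M" using pow[OF a(1)] p1 by simp
    then have "[int (e a) = int (p - 1)] (mod int p)" using uniq'[OF a(1) e[OF a(1)]] by blast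
    then have "int p dvd int (e a) - (int p - 1)"
      using p1 by (simp add: cong_iff_dvd_diff of_nat_diff)
    moreover have "f a - 1 = - (int (e a) - (int p - 1)) - int p" by (simp add: f_def)
    ultimately show ?thesis
      unfolding cong_iff_dvd_diff by (metis dvd_diff dvd_minus_iff dvd_refl)
  qed
  ultimately show ?thesis by blast
qed

end

section \<open>Dual bases of elementary abelian sections\<close>

context group begin

text \<open>Lifts to \<open>K\<close> of a basis of \<open>K / N\<close> over the field with
  \<open>p\<close> elements, together with the dual basis of functionals; \<open>m\<close> is the
  dimension.\<close>

definition dual_system :: "nat \<Rightarrow> 'a set \<Rightarrow> 'a set \<Rightarrow> nat \<Rightarrow> (nat \<Rightarrow> 'a) \<Rightarrow> (nat \<Rightarrow> 'a \<Rightarrow> int) \<Rightarrow> bool" where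
  "dual_system p K N m x \<mu> \<longleftrightarrow>
     (\<forall>i<m. x i \<in> K \<and> functional p K (\<mu> i)) \<and>
     (\<forall>i<m. \<forall>j<m. [\<mu> i (x j) = (if i = j then 1 else 0)] (mod int p)) \<and>
     N = {g \<in> K. \<forall>i<m. int p dvd \<mu> i g}"

text \<open>The lift of the vector with coordinates \<open>a\<close>, an ordered product since the
  \<open>x i\<close> need not commute.\<close>

fun word :: "(nat \<Rightarrow> 'a) \<Rightarrow> (nat \<Rightarrow> nat) \<Rightarrow> nat \<Rightarrow> 'a" where
  "word x a 0 = \<one>"
| "word x a (Suc j) = word x a j \<otimes> x j [^] a j"

lemma word_mem: "subgroup K G \<Longrightarrow> (\<And>i. i < m \<Longrightarrow> x i \<in> K) \<Longrightarrow> word x a m \<in> K"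
  by (induction m) (auto simp: subgroup.one_closed subgroup.m_closed subgroup_nat_pow_closed)

lemma functional_word:
  assumes f: "functional p K f" and K: "subgroup K G" and "\<And>i. i < m \<Longrightarrow> x i \<in> K"
  shows "[f (word x a m) = (\<Sum>i<m. int (a i) * f (x i))] (mod int p)"
  using assms(3)
proof (induction m)
  case 0
  then show ?case using functional_one[OF f K] by simp
next
  case (Suc m)
  have "[f (word x a m \<otimes> x m [^] a m) = f (word x a m) + f (x m [^] a m)] (mod int p)"
    using Suc.prems by (intro functional_mult[OF f] word_mem[OF K] subgroup_nat_pow_closed[OF K]) auto
  moreover have "[f (word x a m) + f (x m [^] a m) =
      (\<Sum>i<m. int (a i) * f (x i)) + int (a m) * f (x m)] (mod int p)"
    using Suc by (intro cong_add functional_pow[OF f K]) auto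
  ultimately have "[f (word x a m \<otimes> x m [^] a m) =
      (\<Sum>i<m. int (a i) * f (x i)) + int (a m) * f (x m)] (mod int p)"
    by (rule cong_trans)
  then show ?case by simp
qed

lemma dual_systemD:
  assumes "dual_system p K N m x \<mu>"
  shows "i < m \<Longrightarrow> x i \<in> K" and "i < m \<Longrightarrow> functional p K (\<mu> i)"
    and "i < m \<Longrightarrow> j < m \<Longrightarrow> [\<mu> i (x j) = (if i = j then 1 else 0)] (mod int p)"
    and "g \<in> N \<longleftrightarrow> g \<in> K \<and> (\<forall>i<m. int p dvd \<mu> i g)"
  using assms unfolding dual_system_def by blast+

text \<open>Subtracting from \<open>f\<close> its values on the old basis makes it vanish there. The
  old functionals already vanish at the new basis element \<open>a\<close>, as \<open>a\<close> lies
  in \<open>N\<close>.\<close>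

lemma dual_system_extend:
  assumes ds: "dual_system p K N m x \<mu>" and f: "functional p K f"
    and a: "a \<in> N" "[f a = 1] (mod int p)"
  shows "\<exists>x' \<mu>'. dual_system p K {g \<in> N. int p dvd f g} (Suc m) x' \<mu>'"
proof -
  define f' where "f' g = f g + (\<Sum>j<m. (- f (x j)) * \<mu> j g)" for g
  have aK: "a \<in> K" and \<mu>a: "\<And>i. i < m \<Longrightarrow> [\<mu> i a = 0] (mod int p)"
    using dual_systemD(4)[OF ds] a by (auto simp: cong_0_iff)
  have f': "functional p K f'"
    unfolding f'_def by (intro functional_add functional_sum functional_scale f dual_systemD(2)[OF ds]) simp
  have f'N: "[f' g = f g] (mod int p)" if "g \<in> N" for g
  proof -
    have "[f' g = f g + (\<Sum>j<m. (- f (x j)) * 0)] (mod int p)"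
      unfolding f'_def
      by (intro cong_add cong_sum cong_mult cong_refl) (use dual_systemD(4)[OF ds] that in \<open>auto simp: cong_0_iff\<close>)
    then show ?thesis by simp
  qed
  have f'x: "[f' (x i) = 0] (mod int p)" if i: "i < m" for i
  proof -
    have "[f' (x i) = f (x i) + (\<Sum>j<m. (- f (x j)) * (if j = i then 1 else 0))] (mod int p)"
      unfolding f'_def by (intro cong_add cong_sum cong_mult cong_refl dual_systemD(3)[OF ds]) (use i in auto)
    also have "f (x i) + (\<Sum>j<m. (- f (x j)) * (if j = i then 1 else 0)) = 0"
      using i by (simp add: if_distrib[of "\<lambda>t. _ * t"] cong: if_cong)
    finally show ?thesis .
  qed
  have f'a: "[f' a = 1] (mod int p)" using f'N a cong_trans by blast
  let ?x = "x(m := a)" and ?\<mu> = "\<mu>(m := f')"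
  have "dual_system p K {g \<in> N. int p dvd f g} (Suc m) ?x ?\<mu>"
    unfolding dual_system_def
  proof (intro conjI allI impI)
    fix i j assume "i < Suc m" "j < Suc m"
    then show "[?\<mu> i (?x j) = (if i = j then 1 else 0)] (mod int p)"
      using f'a f'x \<mu>a dual_systemD(3)[OF ds, of i j]
      by (cases "i = m"; cases "j = m"; simp add: less_Suc_eq)
  next
    show "{g \<in> N. int p dvd f g} = {g \<in> K. \<forall>i<Suc m. int p dvd ?\<mu> i g}"
    proof (rule Set.set_eqI)
      fix g
      have "(\<forall>i<Suc m. int p dvd ?\<mu> i g) \<longleftrightarrow> (\<forall>i<m. int p dvd \<mu> i g) \<and> int p dvd f' g"
        by (auto simp: less_Suc_eq)
      moreover have "g \<in> N \<Longrightarrow> int p dvd f' g \<longleftrightarrow> int p dvd f g" by (rule cong_dvd_iff[OF f'N])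
      ultimately show "g \<in> {g \<in> N. int p dvd f g} \<longleftrightarrow> g \<in> {g \<in> K. \<forall>i<Suc m. int p dvd ?\<mu> i g}"
        unfolding mem_Collect_eq using dual_systemD(4)[OF ds, of g] by argo
    qed
  next
    fix i assume "i < Suc m"
    then consider "i < m" | "i = m" by linarith
    then have "?x i \<in> K \<and> functional p K (?\<mu> i)"
    proof cases
      case 1
      with dual_systemD(1,2)[OF ds 1] show ?thesis by simp
    next
      case 2
      with aK f' show ?thesis by simp
    qed
    then show "?x i \<in> K" "functional p K (?\<mu> i)" by blast+
  qed
  then show ?thesis by blast
qed

text \<open>Start with the empty system for \<open>K\<close> over itself and choose \<open>L\<close>
  of least size over which a dual system exists. A functional separating a point of \<open>L\<close>
  from \<open>N\<close> would cut \<open>L\<close> down further.\<close>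

lemma dual_system_exists:
  assumes fin: "finite (carrier G)" and p: "Factorial_Ring.prime p" and EP: "elementary_pair p K N"
  shows "\<exists>m x \<mu>. dual_system p K N m x \<mu>"
proof -
  have K: "K \<subseteq> carrier G" "N \<subseteq> K" using EP subgroup.subset by (auto simp: elementary_pair_def)
  define P where "P L \<longleftrightarrow> N \<subseteq> L \<and> L \<subseteq> K \<and> (\<exists>m x \<mu>. dual_system p K L m x \<mu>)" for L
  have "dual_system p K K 0 (\<lambda>_. undefined) (\<lambda>_. undefined)" by (simp add: dual_system_def)
  then have "P K" using K by (auto simp: P_def)
  from ex_has_least_nat[of P, OF this, of card]
  obtain L where PL: "P L" and min: "\<And>M. P M \<Longrightarrow> card L \<le> card M" by blast
  then have L: "N \<subseteq> L" "L \<subseteq> K" by (simp_all add: P_def)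
  have "L = N"
  proof (rule ccontr)
    assume "L \<noteq> N"
    then obtain a where a: "a \<in> L" "a \<notin> N" using L by blast
    then obtain f where f: "functional p K f" "\<forall>g\<in>N. int p dvd f g" "[f a = 1] (mod int p)"
      using exists_functional[OF fin p EP, of a] L by blast
    obtain m x \<mu> where "dual_system p K L m x \<mu>" using PL unfolding P_def by blast
    from dual_system_extend[OF this f(1) a(1) f(3)]
    have "P {g \<in> L. int p dvd f g}" unfolding P_def using L f(2) by blast
    have "\<not> int p dvd f a"
      using cong_dvd_iff[OF f(3)] prime_gt_1_nat[OF p] by simp
    then have "{g \<in> L. int p dvd f g} \<subset> L" using a by blast
    moreover have "finite L" using L K fin by (meson finite_subset)
    ultimately have "card {g \<in> L. int p dvd f g} < card L" by (intro psubset_card_mono)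
    with min[OF \<open>P {g \<in> L. int p dvd f g}\<close>] show False by simp
  qed
  with PL show ?thesis by (simp add: P_def)
qed

text \<open>The word \<open>w\<close> with the coordinates of \<open>g\<close> agrees with
  \<open>g\<close> modulo \<open>N\<close>, and \<open>f\<close> at a word is a combination of the
  values \<open>f (x i)\<close>.\<close>

lemma functional_vanishes:
  assumes p: "Factorial_Ring.prime p" and K: "subgroup K G" and ds: "dual_system p K N m x \<mu>"
    and f: "functional p K f" and fN: "\<And>g. g \<in> N \<Longrightarrow> int p dvd f g"
    and fx: "\<And>i. i < m \<Longrightarrow> int p dvd f (x i)" and g: "g \<in> K"
  shows "int p dvd f g"
proof -
  have p0: "p > 0" using prime_gt_0_nat[OF p] .
  define w where "w = word x (\<lambda>i. nat (\<mu> i g mod int p)) m"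
  have w: "w \<in> K" unfolding w_def by (rule word_mem[OF K dual_systemD(1)[OF ds]])
  have val: "[f w = (\<Sum>i<m. (\<mu> i g mod int p) * f (x i))] (mod int p)" if "functional p K f" for f
    using functional_word[OF that K dual_systemD(1)[OF ds], of m "\<lambda>i. i" "\<lambda>i. nat (\<mu> i g mod int p)"] p0
    by (simp add: w_def)
  have "g \<otimes> inv w \<in> N"
    unfolding dual_systemD(4)[OF ds]
  proof (intro conjI allI impI)
    show "g \<otimes> inv w \<in> K" using g w subgroup.m_closed[OF K] subgroup.m_inv_closed[OF K] by blast
    fix i assume i: "i < m"
    have "[\<mu> i w = (\<Sum>j<m. (\<mu> j g mod int p) * \<mu> i (x j))] (mod int p)"
      by (rule val[OF dual_systemD(2)[OF ds i]])
    also have "[(\<Sum>j<m. (\<mu> j g mod int p) * \<mu> i (x j)) = (\<Sum>j<m. (\<mu> j g mod int p) * (if i = j then 1 else 0))] (mod int p)"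
      using i by (intro cong_sum cong_mult cong_refl dual_systemD(3)[OF ds]) auto
    also have "(\<Sum>j<m. (\<mu> j g mod int p) * (if i = j then 1 else 0)) = \<mu> i g mod int p"
      using i by (simp add: if_distrib[of "\<lambda>t. _ * t"] cong: if_cong)
    finally have "[\<mu> i w = \<mu> i g] (mod int p)" by simp
    moreover have "[\<mu> i (g \<otimes> inv w) = \<mu> i g - \<mu> i w] (mod int p)"
      by (rule functional_diff[OF dual_systemD(2)[OF ds i] K g w])
    ultimately show "int p dvd \<mu> i (g \<otimes> inv w)"
      unfolding cong_iff_dvd_diff by (meson cong_dvd_iff cong_iff_dvd_diff dvd_diff_commute)
  qed
  then have "int p dvd f (g \<otimes> inv w)" by (rule fN)
  moreover have "[f (g \<otimes> inv w) = f g - f w] (mod int p)" by (rule functional_diff[OF f K g w])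
  moreover have "int p dvd (\<Sum>i<m. (\<mu> i g mod int p) * f (x i))" using fx by (intro dvd_sum) auto
  then have "int p dvd f w" using val[OF f] cong_dvd_iff by blast
  ultimately show ?thesis using cong_dvd_iff dvd_diff_left_iff by blast
qed

lemma PiE_mod_mem: "p > 0 \<Longrightarrow> (\<lambda>i\<in>{..<m}. t i mod int p) \<in> {..<m} \<rightarrow>\<^sub>E int ` {..<p}"
proof (intro restrict_PiE_iff[THEN iffD2] ballI)
  fix i assume "p > 0"
  then show "t i mod int p \<in> int ` {..<p}"
    by (intro image_eqI[of _ int "nat (t i mod int p)"]) (auto simp: nat_less_iff)
qed

lemma card_residue_vectors: "card ({..<m} \<rightarrow>\<^sub>E int ` {..<p}) = p ^ m"
  by (simp add: card_PiE card_image)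

lemma card_eq_sum_fibres:
  assumes "finite K" "finite V" "T ` K \<subseteq> V"
  shows "card K = (\<Sum>v\<in>V. card {g \<in> K. T g = v})"
  using sum.group[OF assms, of "\<lambda>_. 1 :: nat"] by simp

text \<open>The coordinate map to residue vectors is onto, words giving preimages, and its fibres
  are cosets of \<open>N\<close>.\<close>

lemma card_dual_system:
  assumes fin: "finite (carrier G)" and p: "Factorial_Ring.prime p"
    and K: "subgroup K G" and ds: "dual_system p K N m x \<mu>"
  shows "card K = p ^ m * card N"
proof -
  have p0: "p > 0" using prime_gt_0_nat[OF p] .
  let ?V = "{..<m} \<rightarrow>\<^sub>E int ` {..<p}"
  define T where "T g = (\<lambda>i\<in>{..<m}. \<mu> i g mod int p)" for g
  have finK: "finite K" using fin subgroup.subset[OF K] finite_subset by blast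
  have Kc: "\<And>g. g \<in> K \<Longrightarrow> g \<in> carrier G" using subgroup.mem_carrier[OF K] .
  have T_eq: "T g = T h \<longleftrightarrow> (\<forall>i<m. [\<mu> i g = \<mu> i h] (mod int p))" for g h
    by (auto simp: T_def restrict_def fun_eq_iff cong_def)
  have fibre: "card {g \<in> K. T g = v} = card N" if v: "v \<in> ?V" for v
  proof -
    define w where "w = word x (\<lambda>i. nat (v i)) m"
    have w: "w \<in> K" unfolding w_def by (rule word_mem[OF K dual_systemD(1)[OF ds]])
    have vb: "v i \<ge> 0 \<and> v i mod int p = v i" if "i < m" for i
      using PiE_mem[OF v, of i] that by auto
    have "\<mu> i w mod int p = v i" if i: "i < m" for i
    proof -
      have "[\<mu> i w = (\<Sum>j<m. int (nat (v j)) * \<mu> i (x j))] (mod int p)"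
        unfolding w_def by (rule functional_word[OF dual_systemD(2)[OF ds i] K dual_systemD(1)[OF ds]])
      also have "[(\<Sum>j<m. int (nat (v j)) * \<mu> i (x j)) = (\<Sum>j<m. int (nat (v j)) * (if i = j then 1 else 0))] (mod int p)"
        using i by (intro cong_sum cong_mult cong_refl dual_systemD(3)[OF ds]) auto
      also have "(\<Sum>j<m. int (nat (v j)) * (if i = j then 1 else 0)) = v i"
        using i vb by (simp add: if_distrib[of "\<lambda>t. _ * t"] cong: if_cong)
      finally show ?thesis using vb i by (simp add: cong_def)
    qed
    then have Tw: "T w = v"
      using v by (auto simp: T_def fun_eq_iff restrict_def PiE_def extensional_def)
    have "bij_betw (\<lambda>g. g \<otimes> inv w) {g \<in> K. T g = v} N"
    proof (rule bij_betw_byWitness[of _ "\<lambda>g. g \<otimes> w"])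
      show "\<forall>g\<in>{g \<in> K. T g = v}. g \<otimes> inv w \<otimes> w = g" using Kc w by (simp add: m_assoc)
      have NK: "N \<subseteq> K" using dual_systemD(4)[OF ds] by blast
      then show "\<forall>g\<in>N. g \<otimes> w \<otimes> inv w = g" using Kc w by (auto simp: m_assoc)
      show "(\<lambda>g. g \<otimes> inv w) ` {g \<in> K. T g = v} \<subseteq> N"
      proof safe
        fix g assume g: "g \<in> K" "v = T g"
        then have *: "T g = T w" using Tw by simp
        show "g \<otimes> inv w \<in> N"
          unfolding dual_systemD(4)[OF ds]
        proof (intro conjI allI impI)
          show "g \<otimes> inv w \<in> K" using g w subgroup.m_closed[OF K] subgroup.m_inv_closed[OF K] by blast
          fix i assume i: "i < m"
          have "[\<mu> i (g \<otimes> inv w) = \<mu> i g - \<mu> i w] (mod int p)"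
            by (rule functional_diff[OF dual_systemD(2)[OF ds i] K g(1) w])
          then show "int p dvd \<mu> i (g \<otimes> inv w)"
            using * i unfolding T_eq by (meson cong_dvd_iff cong_iff_dvd_diff)
        qed
      qed
      show "(\<lambda>g. g \<otimes> w) ` N \<subseteq> {g \<in> K. T g = v}"
      proof safe
        fix g assume g: "g \<in> N"
        then have gK: "g \<in> K" using NK by blast
        then show "g \<otimes> w \<in> K" using w subgroup.m_closed[OF K] by blast
        have "[\<mu> i (g \<otimes> w) = \<mu> i w] (mod int p)" if i: "i < m" for i
        proof -
          have "[\<mu> i (g \<otimes> w) = \<mu> i g + \<mu> i w] (mod int p)"
            by (rule functional_mult[OF dual_systemD(2)[OF ds i] gK w])
          moreover have "[\<mu> i g + \<mu> i w = 0 + \<mu> i w] (mod int p)"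
            using g dual_systemD(4)[OF ds] i by (intro cong_add cong_refl) (auto simp: cong_0_iff)
          ultimately show ?thesis using cong_trans by fastforce
        qed
        then show "T (g \<otimes> w) = v" using Tw T_eq by blast
      qed
    qed
    then show ?thesis by (rule bij_betw_same_card)
  qed
  have "card K = (\<Sum>v\<in>?V. card {g \<in> K. T g = v})"
    by (rule card_eq_sum_fibres[OF finK]) (simp_all only: T_def image_subset_iff PiE_mod_mem[OF p0] finite_PiE finite_lessThan finite_imageI ball_triv simp_thms)
  also have "\<dots> = (\<Sum>v\<in>?V. card N)" by (intro sum.cong refl fibre)
  finally show ?thesis by (simp add: card_residue_vectors)
qed

text \<open>Modulo the left kernel, which lies in \<open>A'\<close>, an element of \<open>A\<close>
  is determined by its \<open>r\<close> values on a basis of \<open>B / B'\<close>. So there are at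
  most \<open>p ^ r\<close> classes, and \<open>p ^ r\<close> is the index of \<open>B'\<close> in
  \<open>B\<close>.\<close>

lemma card_pairing_le:
  assumes fin: "finite (carrier G)" and p: "Factorial_Ring.prime p"
    and A: "subgroup A G" and BB: "elementary_pair p B B'"
    and fB: "\<And>a. a \<in> A \<Longrightarrow> functional p B (f a)" and fA: "\<And>b. b \<in> B \<Longrightarrow> functional p A (\<lambda>a. f a b)"
    and B': "\<And>a b. a \<in> A \<Longrightarrow> b \<in> B' \<Longrightarrow> int p dvd f a b"
    and A': "\<And>a. a \<in> A \<Longrightarrow> (\<And>b. b \<in> B \<Longrightarrow> int p dvd f a b) \<Longrightarrow> a \<in> A'" "finite A'"
  shows "card A * card B' \<le> card B * card A'"
proof -
  have p0: "p > 0" using prime_gt_0_nat[OF p] .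
  have B: "subgroup B G" using BB by (simp add: elementary_pair_def)
  obtain r x \<mu> where ds: "dual_system p B B' r x \<mu>" using dual_system_exists[OF fin p BB] by blast
  let ?V = "{..<r} \<rightarrow>\<^sub>E int ` {..<p}"
  define T where "T a = (\<lambda>i\<in>{..<r}. f a (x i) mod int p)" for a
  have finA: "finite A" using fin subgroup.subset[OF A] finite_subset by blast
  have Ac: "\<And>g. g \<in> A \<Longrightarrow> g \<in> carrier G" using subgroup.mem_carrier[OF A] .
  have fibre: "card {a \<in> A. T a = v} \<le> card A'" for v
  proof (cases "{a \<in> A. T a = v} = {}")
    case False
    then obtain a where a: "a \<in> A" "T a = v" by blast
    have "inj_on (\<lambda>g. g \<otimes> inv a) {a \<in> A. T a = v}"
      by (rule inj_onI) (use Ac a in auto)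
    moreover have "(\<lambda>g. g \<otimes> inv a) ` {a \<in> A. T a = v} \<subseteq> A'"
    proof safe
      fix g assume g: "g \<in> A" "v = T g"
      then have ga: "g \<otimes> inv a \<in> A" using a subgroup.m_closed[OF A] subgroup.m_inv_closed[OF A] by blast
      show "g \<otimes> inv a \<in> A'"
      proof (rule A'(1)[OF ga], rule functional_vanishes[OF p B ds fB[OF ga] B'[OF ga]])
        fix i assume i: "i < r"
        have "T g i = T a i" using g a by simp
        then have "[f g (x i) = f a (x i)] (mod int p)" using i by (simp add: T_def cong_def)
        moreover have "[f (g \<otimes> inv a) (x i) = f g (x i) - f a (x i)] (mod int p)"
          by (rule functional_diff[OF fA[OF dual_systemD(1)[OF ds i]] A g(1) a(1)])
        ultimately show "int p dvd f (g \<otimes> inv a) (x i)"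
          by (meson cong_dvd_iff cong_iff_dvd_diff)
      qed
    qed
    ultimately show ?thesis using card_inj_on_le A'(2) by blast
  next
    case True
    show ?thesis unfolding True by simp
  qed
  have "card A = (\<Sum>v\<in>?V. card {g \<in> A. T g = v})"
    by (rule card_eq_sum_fibres[OF finA]) (simp_all only: T_def image_subset_iff PiE_mod_mem[OF p0] finite_PiE finite_lessThan finite_imageI ball_triv simp_thms)
  also have "\<dots> \<le> (\<Sum>v\<in>?V. card A')" by (intro sum_mono fibre)
  finally have "card A \<le> p ^ r * card A'" by (simp add: card_residue_vectors)
  then have "card A * card B' \<le> p ^ r * card A' * card B'" by (rule mult_le_mono1)
  then show ?thesis using card_dual_system[OF fin p B ds] by (simp add: mult_ac)
qed

end

section \<open>Camina groups of class three\<close>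

context group begin

section \<open>Commutator identities\<close>

lemma commutator_closed [simp]:
  "x \<in> carrier G \<Longrightarrow> y \<in> carrier G \<Longrightarrow> commutator G x y \<in> carrier G"
  by (simp add: commutator_def)

lemma commutator_inv:
  "x \<in> carrier G \<Longrightarrow> y \<in> carrier G \<Longrightarrow> inv (commutator G x y) = commutator G y x"
  by (simp add: commutator_def inv_mult_group m_assoc)

lemma commutator_self: "x \<in> carrier G \<Longrightarrow> commutator G x x = \<one>"
  by (simp add: commutator_def m_assoc mult_inv_cancel inv_mult_cancel)

lemma conj_eq_mult_commutator:
  "x \<in> carrier G \<Longrightarrow> y \<in> carrier G \<Longrightarrow> inv y \<otimes> x \<otimes> y = x \<otimes> commutator G x y"
  by (simp add: commutator_def m_assoc mult_inv_cancel)

text \<open>The conjugate of \<open>[x, z]\<close> by \<open>y\<close> is written as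
  \<open>[x, z] [[x, z], y]\<close>, so that the defect from multiplicativity is a triple
  commutator.\<close>

lemma commutator_mult_left:
  "x \<in> carrier G \<Longrightarrow> y \<in> carrier G \<Longrightarrow> z \<in> carrier G \<Longrightarrow>
    commutator G (x \<otimes> y) z = commutator G x z \<otimes> commutator G (commutator G x z) y \<otimes> commutator G y z"
  by (simp add: commutator_def m_assoc mult_inv_cancel inv_mult_cancel inv_mult_group)

lemma commutator_mult_right:
  "x \<in> carrier G \<Longrightarrow> y \<in> carrier G \<Longrightarrow> z \<in> carrier G \<Longrightarrow>
    commutator G x (y \<otimes> z) = commutator G x z \<otimes> commutator G x y \<otimes> commutator G (commutator G x y) z"
  by (simp add: commutator_def m_assoc mult_inv_cancel inv_mult_cancel inv_mult_group)

lemma commutator_eq_one_iff: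
  assumes "x \<in> carrier G" "y \<in> carrier G"
  shows "commutator G x y = \<one> \<longleftrightarrow> x \<otimes> y = y \<otimes> x"
proof -
  have "y \<otimes> x \<otimes> commutator G x y = x \<otimes> y"
    using assms by (simp add: commutator_def m_assoc mult_inv_cancel)
  moreover have "y \<otimes> x \<otimes> commutator G x y = y \<otimes> x \<longleftrightarrow> commutator G x y = \<one>"
    using assms by (intro l_cancel_one) simp_all
  ultimately show ?thesis by simp
qed

end

section \<open>The lower central series and its elementary abelian factors\<close>

locale camina_p_group_class_3 = group G for G (structure) +
  fixes p :: nat
  assumes prime: "Factorial_Ring.prime p"
    and p_group: "finite_p_group p G"
    and camina: "camina_group G"
    and class_3: "nilpotent_of_class G 3"
begin

abbreviation comm where "comm \<equiv> commutator G"
abbreviation \<gamma>\<^sub>2 where "\<gamma>\<^sub>2 \<equiv> lower_central G 2"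
abbreviation \<gamma>\<^sub>3 where "\<gamma>\<^sub>3 \<equiv> lower_central G 3"

lemma fin: "finite (carrier G)"
  using p_group by (simp add: finite_p_group_def)

lemma \<gamma>2_generate: "\<gamma>\<^sub>2 = generate G {comm x y | x y. x \<in> carrier G \<and> y \<in> carrier G}"
  by (simp add: numeral_2_eq_2 commutator_subgroup_def)

lemma \<gamma>3_generate: "\<gamma>\<^sub>3 = generate G {comm u y | u y. u \<in> \<gamma>\<^sub>2 \<and> y \<in> carrier G}"
  by (simp add: lower_central_3 commutator_subgroup_def)

lemma \<gamma>4: "commutator_subgroup G \<gamma>\<^sub>3 (carrier G) = {\<one>}"
  using class_3 by (simp add: nilpotent_of_class_def numeral_3_eq_3)

lemma \<gamma>3_nontrivial: "\<gamma>\<^sub>3 \<noteq> {\<one>}"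
proof -
  have "\<forall>d<3. lower_central G (d + 1) \<noteq> {\<one>}" using class_3 unfolding nilpotent_of_class_def by blast
  then have "lower_central G (2 + 1) \<noteq> {\<one>}" by (rule allE[of _ 2]) (elim mp, simp)
  then show ?thesis by simp
qed

lemma \<gamma>2_subgroup: "subgroup \<gamma>\<^sub>2 G"
  unfolding \<gamma>2_generate by (rule generate_is_subgroup) auto

lemma \<gamma>2_carrier: "u \<in> \<gamma>\<^sub>2 \<Longrightarrow> u \<in> carrier G"
  by (rule subgroup.mem_carrier[OF \<gamma>2_subgroup])

lemma \<gamma>3_subgroup: "subgroup \<gamma>\<^sub>3 G"
  unfolding \<gamma>3_generate by (rule generate_is_subgroup) (auto simp: \<gamma>2_carrier)

lemma comm_mem_\<gamma>2: "x \<in> carrier G \<Longrightarrow> y \<in> carrier G \<Longrightarrow> comm x y \<in> \<gamma>\<^sub>2"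
  unfolding \<gamma>2_generate by (rule generate.incl) blast

lemma comm_mem_\<gamma>3: "u \<in> \<gamma>\<^sub>2 \<Longrightarrow> y \<in> carrier G \<Longrightarrow> comm u y \<in> \<gamma>\<^sub>3"
  unfolding \<gamma>3_generate by (rule generate.incl) blast

lemma \<gamma>3_sub: "\<gamma>\<^sub>3 \<subseteq> \<gamma>\<^sub>2"
  unfolding \<gamma>3_generate
  by (rule generate_subgroup_incl[OF _ \<gamma>2_subgroup]) (auto intro: comm_mem_\<gamma>2 \<gamma>2_carrier)

lemma \<gamma>3_carrier: "u \<in> \<gamma>\<^sub>3 \<Longrightarrow> u \<in> carrier G"
  by (rule subgroup.mem_carrier[OF \<gamma>3_subgroup])

lemma comm_mem_\<gamma>3': "x \<in> carrier G \<Longrightarrow> u \<in> \<gamma>\<^sub>2 \<Longrightarrow> comm x u \<in> \<gamma>\<^sub>3"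
  using comm_mem_\<gamma>3[of u x] commutator_inv[of u x] \<gamma>2_carrier subgroup.m_inv_closed[OF \<gamma>3_subgroup]
  by metis

lemma comm_\<gamma>3: "z \<in> \<gamma>\<^sub>3 \<Longrightarrow> y \<in> carrier G \<Longrightarrow> comm z y = \<one>"
proof -
  assume "z \<in> \<gamma>\<^sub>3" "y \<in> carrier G"
  then have "comm z y \<in> commutator_subgroup G \<gamma>\<^sub>3 (carrier G)"
    unfolding commutator_subgroup_def by (intro generate.incl) blast
  then show ?thesis using \<gamma>4 by simp
qed

lemma \<gamma>3_central: "z \<in> \<gamma>\<^sub>3 \<Longrightarrow> y \<in> carrier G \<Longrightarrow> z \<otimes> y = y \<otimes> z"
  using comm_\<gamma>3 commutator_eq_one_iff \<gamma>3_carrier by blast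

text \<open>Equality would give \<open>\<gamma>\<^sub>3 = [\<gamma>\<^sub>2, G] =
  [\<gamma>\<^sub>3, G] = 1\<close>.\<close>

lemma \<gamma>2_neq_\<gamma>3: "\<gamma>\<^sub>2 \<noteq> \<gamma>\<^sub>3"
proof
  assume "\<gamma>\<^sub>2 = \<gamma>\<^sub>3"
  then have "\<gamma>\<^sub>3 = {\<one>}" using lower_central_3[of G] \<gamma>4 by simp
  then show False using \<gamma>3_nontrivial by blast
qed

lemma \<gamma>2_neq_carrier: "\<gamma>\<^sub>2 \<noteq> carrier G"
proof
  assume "\<gamma>\<^sub>2 = carrier G"
  then have "\<gamma>\<^sub>3 = \<gamma>\<^sub>2" using \<gamma>2_generate \<gamma>3_generate by simp
  then show False using \<gamma>2_neq_\<gamma>3 by simp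
qed

lemma obtain_outside: obtains x where "x \<in> carrier G" "x \<notin> \<gamma>\<^sub>2"
  using \<gamma>2_neq_carrier subgroup.subset[OF \<gamma>2_subgroup] by blast

text \<open>Here the Camina condition enters: the conjugates of \<open>x\<close> are the elements
  \<open>x [x, y]\<close>, and they fill the coset of \<open>x\<close>.\<close>

lemma comm_surj_\<gamma>2:
  assumes "x \<in> carrier G" "x \<notin> \<gamma>\<^sub>2" "u \<in> \<gamma>\<^sub>2"
  shows "\<exists>y\<in>carrier G. comm x y = u"
proof -
  have "x \<otimes> u \<in> conjugacy_class G x"
    using camina assms by (auto simp: camina_group_def l_coset_def)
  then obtain y where y: "y \<in> carrier G" "x \<otimes> u = inv y \<otimes> x \<otimes> y"
    by (auto simp: conjugacy_class_def)
  then have "x \<otimes> u = x \<otimes> comm x y" using assms(1) by (simp add: conj_eq_mult_commutator)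
  then have "u = comm x y" using assms y \<gamma>2_carrier by simp
  with y show ?thesis by blast
qed

lemma comm_\<gamma>2_mult_right:
  assumes "u \<in> \<gamma>\<^sub>2" "y \<in> carrier G" "z \<in> carrier G"
  shows "comm u (y \<otimes> z) = comm u y \<otimes> comm u z"
  using assms by (simp add: commutator_mult_right \<gamma>2_carrier comm_\<gamma>3[OF comm_mem_\<gamma>3]
      \<gamma>3_central[OF comm_mem_\<gamma>3[OF assms(1,3)], of "comm u y"])

text \<open>For \<open>u\<close> in \<open>\<gamma>\<^sub>2\<close> the map sending \<open>y\<close>
  to \<open>[u, y]\<close> is a homomorphism into the central subgroup
  \<open>\<gamma>\<^sub>3\<close>, hence kills every commutator.\<close>

lemma \<gamma>2_abelian:
  assumes u: "u \<in> \<gamma>\<^sub>2" and v: "v \<in> \<gamma>\<^sub>2"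
  shows "comm u v = \<one>"
  using v unfolding \<gamma>2_generate
proof induction
  case one
  then show ?case using u \<gamma>2_carrier by (simp add: commutator_def)
next
  case (incl h)
  then obtain x y where xy: "x \<in> carrier G" "y \<in> carrier G" "h = comm x y" by blast
  have "x \<otimes> y = y \<otimes> x \<otimes> h"
    using xy by (simp add: commutator_def m_assoc mult_inv_cancel)
  then have "comm u (x \<otimes> y) = comm u (y \<otimes> x) \<otimes> comm u h"
    using u xy by (simp add: comm_\<gamma>2_mult_right)
  moreover have "comm u (x \<otimes> y) = comm u (y \<otimes> x)"
    using u xy \<gamma>2_carrier by (simp add: comm_\<gamma>2_mult_right \<gamma>3_central[OF comm_mem_\<gamma>3[OF u xy(1)], of "comm u y"])
  ultimately show ?case using u xy \<gamma>2_carrier by simp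
next
  case (inv h)
  then obtain x y where xy: "x \<in> carrier G" "y \<in> carrier G" "h = comm x y" by blast
  have "x \<otimes> y = y \<otimes> x \<otimes> h"
    using xy by (simp add: commutator_def m_assoc mult_inv_cancel)
  then have "y \<otimes> x = x \<otimes> y \<otimes> inv h"
    using xy by (simp add: m_assoc)
  then have "comm u (y \<otimes> x) = comm u (x \<otimes> y) \<otimes> comm u (inv h)"
    using u xy by (simp add: comm_\<gamma>2_mult_right)
  moreover have "comm u (x \<otimes> y) = comm u (y \<otimes> x)"
    using u xy \<gamma>2_carrier by (simp add: comm_\<gamma>2_mult_right \<gamma>3_central[OF comm_mem_\<gamma>3[OF u xy(1)], of "comm u y"])
  ultimately show ?case using u xy \<gamma>2_carrier by simp
next
  case (eng g h)
  then have "g \<in> carrier G" "h \<in> carrier G"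
    using \<gamma>2_carrier unfolding \<gamma>2_generate by blast+
  then show ?case using eng u by (simp add: comm_\<gamma>2_mult_right)
qed

lemma comm_\<gamma>2_mult_left:
  assumes "u \<in> \<gamma>\<^sub>2" "v \<in> \<gamma>\<^sub>2" "y \<in> carrier G"
  shows "comm (u \<otimes> v) y = comm u y \<otimes> comm v y"
  using assms by (simp add: commutator_mult_left \<gamma>2_carrier comm_\<gamma>3[OF comm_mem_\<gamma>3])

text \<open>Each multiplication by \<open>x\<close> produces a triple commutator in the centre, and
  these are collected at the end.\<close>

lemma comm_pow_mod_\<gamma>3:
  fixes k :: nat
  assumes xy: "x \<in> carrier G" "y \<in> carrier G"
  shows "\<exists>z\<in>\<gamma>\<^sub>3. comm (x [^] k) y = comm x y [^] k \<otimes> z"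
proof (induction k)
  case 0
  show ?case using xy subgroup.one_closed[OF \<gamma>3_subgroup]
    by (intro bexI[of _ \<one>]) (simp_all add: commutator_def)
next
  case (Suc k)
  then obtain z where z: "z \<in> \<gamma>\<^sub>3" "comm (x [^] k) y = comm x y [^] k \<otimes> z" by blast
  let ?t = "comm (comm (x [^] k) y) x"
  have t: "?t \<in> \<gamma>\<^sub>3" using xy by (intro comm_mem_\<gamma>3 comm_mem_\<gamma>2) auto
  then have zt: "z \<otimes> ?t \<in> \<gamma>\<^sub>3" using z subgroup.m_closed[OF \<gamma>3_subgroup] by blast
  have "comm (x [^] Suc k) y = comm x y [^] k \<otimes> (z \<otimes> ?t) \<otimes> comm x y"
    using xy z t \<gamma>3_carrier by (simp add: commutator_mult_left m_assoc)
  also have "\<dots> = comm x y [^] k \<otimes> (comm x y \<otimes> (z \<otimes> ?t))"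
    using xy zt \<gamma>3_carrier[OF zt] \<gamma>3_central[OF zt, of "comm x y"] by (simp add: m_assoc)
  also have "\<dots> = comm x y [^] Suc k \<otimes> (z \<otimes> ?t)"
    using xy \<gamma>3_carrier[OF zt] by (simp add: m_assoc)
  finally show ?case using zt by blast
qed

text \<open>If \<open>x [^] p\<close> were outside \<open>\<gamma>\<^sub>2\<close>, each
  \<open>u\<close> in \<open>\<gamma>\<^sub>2\<close> would be \<open>[x [^] p, y]\<close>, a
  \<open>p\<close>-th power modulo \<open>\<gamma>\<^sub>3\<close>. Iterating up to the group order
  makes \<open>u\<close> trivial modulo \<open>\<gamma>\<^sub>3\<close>, against
  \<open>\<gamma>\<^sub>2 \<noteq> \<gamma>\<^sub>3\<close>.\<close>

lemma pow_mem_\<gamma>2: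
  assumes x: "x \<in> carrier G"
  shows "x [^] p \<in> \<gamma>\<^sub>2"
proof (rule ccontr)
  assume no: "\<not> ?thesis"
  have root: "\<exists>v\<in>\<gamma>\<^sub>2. \<exists>z\<in>\<gamma>\<^sub>3. u = v [^] p \<otimes> z" if u: "u \<in> \<gamma>\<^sub>2" for u
  proof -
    obtain y where y: "y \<in> carrier G" "comm (x [^] p) y = u"
      using comm_surj_\<gamma>2[OF _ no u] x by auto
    then show ?thesis using comm_pow_mod_\<gamma>3[OF x y(1), of p] comm_mem_\<gamma>2[OF x y(1)] by metis
  qed
  have iter: "\<exists>v\<in>\<gamma>\<^sub>2. \<exists>z\<in>\<gamma>\<^sub>3. u = v [^] (p ^ k) \<otimes> z" if u: "u \<in> \<gamma>\<^sub>2" for u and k :: nat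
  proof (induction k)
    case 0
    show ?case using u \<gamma>2_carrier[OF u] subgroup.one_closed[OF \<gamma>3_subgroup]
      by (intro bexI[of _ u] bexI[of _ \<one>]) simp_all
  next
    case (Suc k)
    then obtain v z where v: "v \<in> \<gamma>\<^sub>2" "z \<in> \<gamma>\<^sub>3" "u = v [^] (p ^ k) \<otimes> z" by blast
    obtain v' z' where v': "v' \<in> \<gamma>\<^sub>2" "z' \<in> \<gamma>\<^sub>3" "v = v' [^] p \<otimes> z'" using root[OF v(1)] by blast
    have c: "v' \<in> carrier G" "z' \<in> carrier G" "z \<in> carrier G" using v v' \<gamma>2_carrier \<gamma>3_carrier by auto
    have "v [^] (p ^ k) = (v' [^] p) [^] (p ^ k) \<otimes> z' [^] (p ^ k)"
      unfolding v'(3) by (rule pow_mult_distrib) (use c \<gamma>3_central[OF v'(2)] in auto)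
    then have "u = v' [^] (p ^ Suc k) \<otimes> (z' [^] (p ^ k) \<otimes> z)"
      using v(3) c by (simp add: nat_pow_pow m_assoc)
    moreover have "z' [^] (p ^ k) \<otimes> z \<in> \<gamma>\<^sub>3"
      using v' v subgroup_nat_pow_closed[OF \<gamma>3_subgroup] subgroup.m_closed[OF \<gamma>3_subgroup] by blast
    ultimately show ?case using v'(1) by blast
  qed
  obtain n where n: "Coset.order G = p ^ n" using p_group by (auto simp: finite_p_group_def)
  have "\<gamma>\<^sub>2 \<subseteq> \<gamma>\<^sub>3"
  proof
    fix u assume "u \<in> \<gamma>\<^sub>2"
    then obtain v z where v: "v \<in> \<gamma>\<^sub>2" "z \<in> \<gamma>\<^sub>3" "u = v [^] (p ^ n) \<otimes> z" using iter by blast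
    moreover have "v [^] (p ^ n) = \<one>"
      using pow_order_eq_1[OF \<gamma>2_carrier[OF v(1)]] n by simp
    ultimately show "u \<in> \<gamma>\<^sub>3" using \<gamma>3_carrier by simp
  qed
  then show False using \<gamma>3_sub \<gamma>2_neq_\<gamma>3 by blast
qed

text \<open>Write \<open>u = [x, y]\<close> with \<open>x\<close> outside
  \<open>\<gamma>\<^sub>2\<close>. Modulo \<open>\<gamma>\<^sub>3\<close>, the power is
  \<open>[x [^] p, y]\<close>, and \<open>x [^] p\<close> is in
  \<open>\<gamma>\<^sub>2\<close>.\<close>

lemma pow_mem_\<gamma>3:
  assumes u: "u \<in> \<gamma>\<^sub>2"
  shows "u [^] p \<in> \<gamma>\<^sub>3"
proof -
  obtain x where x: "x \<in> carrier G" "x \<notin> \<gamma>\<^sub>2" by (rule obtain_outside)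
  then obtain y where y: "y \<in> carrier G" "comm x y = u" using comm_surj_\<gamma>2 u by blast
  then obtain z where z: "z \<in> \<gamma>\<^sub>3" "comm (x [^] p) y = u [^] p \<otimes> z" using comm_pow_mod_\<gamma>3[OF x(1) y(1), of p] by blast
  have "u [^] p \<otimes> z \<in> \<gamma>\<^sub>3" using comm_mem_\<gamma>3[OF pow_mem_\<gamma>2[OF x(1)] y(1)] z by simp
  then have "u [^] p \<otimes> z \<otimes> inv z \<in> \<gamma>\<^sub>3"
    using subgroup.m_closed[OF \<gamma>3_subgroup] subgroup.m_inv_closed[OF \<gamma>3_subgroup z(1)] by blast
  then show ?thesis using \<gamma>2_carrier[OF u] \<gamma>3_carrier[OF z(1)] by (simp add: m_assoc)
qed

lemma comm_\<gamma>2_pow: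
  fixes k :: nat
  assumes "u \<in> \<gamma>\<^sub>2" "y \<in> carrier G"
  shows "comm (u [^] k) y = comm u y [^] k"
proof (induction k)
  case 0
  then show ?case using assms by (simp add: commutator_def)
next
  case (Suc k)
  then show ?case using assms subgroup_nat_pow_closed[OF \<gamma>2_subgroup] by (simp add: comm_\<gamma>2_mult_left)
qed

text \<open>On generators, the \<open>p\<close>-th power of \<open>[u, y]\<close> is
  \<open>[u [^] p, y]\<close>, which is trivial as \<open>u [^] p\<close> is central.\<close>

lemma \<gamma>3_pow:
  assumes "z \<in> \<gamma>\<^sub>3"
  shows "z [^] p = \<one>"
  using assms unfolding \<gamma>3_generate
proof induction
  case one
  then show ?case by simp
next
  case (incl h)
  then obtain u y where "u \<in> \<gamma>\<^sub>2" "y \<in> carrier G" "h = comm u y" by blast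
  then show ?case by (simp add: comm_\<gamma>2_pow[symmetric] comm_\<gamma>3[OF pow_mem_\<gamma>3])
next
  case (inv h)
  then obtain u y where "u \<in> \<gamma>\<^sub>2" "y \<in> carrier G" "h = comm u y" by blast
  then show ?case
    using \<gamma>2_carrier by (simp add: nat_pow_inv comm_\<gamma>2_pow[symmetric] comm_\<gamma>3[OF pow_mem_\<gamma>3])
next
  case (eng g h)
  then have "g \<in> \<gamma>\<^sub>3" "h \<in> \<gamma>\<^sub>3" unfolding \<gamma>3_generate by auto
  then show ?case using eng pow_mult_distrib[OF \<gamma>3_central] \<gamma>3_carrier by auto
qed

lemma elementary_carrier: 
  assumes "subgroup D G" "\<gamma>\<^sub>2 \<subseteq> D"
  shows "elementary_pair p (carrier G) D"
  using assms subgroup.subset[OF assms(1)] comm_mem_\<gamma>2 pow_mem_\<gamma>2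
  by (auto simp: elementary_pair_def subgroup_self)

lemma elementary_\<gamma>2:
  assumes "subgroup U G" "\<gamma>\<^sub>3 \<subseteq> U" "U \<subseteq> \<gamma>\<^sub>2"
  shows "elementary_pair p \<gamma>\<^sub>2 U"
  using assms \<gamma>2_abelian pow_mem_\<gamma>3 subgroup.one_closed[OF assms(1)] \<gamma>2_subgroup
  by (auto simp: elementary_pair_def)

lemma elementary_\<gamma>3:
  assumes "subgroup R G" "R \<subseteq> \<gamma>\<^sub>3"
  shows "elementary_pair p \<gamma>\<^sub>3 R"
  using assms \<gamma>3_pow comm_\<gamma>3 subgroup.one_closed[OF assms(1)] \<gamma>3_subgroup \<gamma>3_carrier
  by (auto simp: elementary_pair_def)

end

section \<open>Alternating forms from commutators and the index bound\<close>

context camina_p_group_class_3 begin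

text \<open>The defect from multiplicativity of the commutator lies in
  \<open>\<gamma>\<^sub>3\<close>, where \<open>f\<close> vanishes.\<close>

lemma functional_comm_left:
  assumes f: "functional p \<gamma>\<^sub>2 f" and f0: "\<And>z. z \<in> \<gamma>\<^sub>3 \<Longrightarrow> int p dvd f z" and y: "y \<in> carrier G"
  shows "functional p (carrier G) (\<lambda>x. f (comm x y))"
  unfolding functional_def
proof (intro ballI)
  fix a b assume ab: "a \<in> carrier G" "b \<in> carrier G"
  let ?s = "comm a y" and ?t = "comm (comm a y) b" and ?r = "comm b y"
  have mem: "?s \<in> \<gamma>\<^sub>2" "?t \<in> \<gamma>\<^sub>3" "?t \<in> \<gamma>\<^sub>2" "?r \<in> \<gamma>\<^sub>2"
    using ab y comm_mem_\<gamma>2 comm_mem_\<gamma>3 \<gamma>3_sub by blast+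
  have "[f (?s \<otimes> ?t \<otimes> ?r) = f (?s \<otimes> ?t) + f ?r] (mod int p)"
    using mem subgroup.m_closed[OF \<gamma>2_subgroup] by (intro functional_mult[OF f]) auto
  moreover have "[f (?s \<otimes> ?t) + f ?r = (f ?s + f ?t) + f ?r] (mod int p)"
    by (intro cong_add cong_refl functional_mult[OF f] mem)
  moreover have "[(f ?s + f ?t) + f ?r = (f ?s + 0) + f ?r] (mod int p)"
    by (intro cong_add cong_refl) (simp add: cong_0_iff f0 mem)
  ultimately show "[f (comm (a \<otimes> b) y) = f ?s + f ?r] (mod int p)"
    using ab y by (simp add: commutator_mult_left) (blast intro: cong_trans)
qed

lemma functional_comm_swap:
  assumes f: "functional p \<gamma>\<^sub>2 f" and "x \<in> carrier G" "y \<in> carrier G"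
  shows "[f (comm x y) = - f (comm y x)] (mod int p)"
  using functional_inv[OF f \<gamma>2_subgroup comm_mem_\<gamma>2, of y x] assms by (simp add: commutator_inv)

lemma functional_comm_right:
  assumes f: "functional p \<gamma>\<^sub>2 f" and f0: "\<And>z. z \<in> \<gamma>\<^sub>3 \<Longrightarrow> int p dvd f z" and x: "x \<in> carrier G"
  shows "functional p (carrier G) (\<lambda>y. f (comm x y))"
  unfolding functional_def
proof (intro ballI)
  fix a b assume ab: "a \<in> carrier G" "b \<in> carrier G"
  have "[f (comm x (a \<otimes> b)) = - f (comm (a \<otimes> b) x)] (mod int p)"
    using ab x by (intro functional_comm_swap[OF f]) auto
  also have "[- f (comm (a \<otimes> b) x) = - (f (comm a x) + f (comm b x))] (mod int p)"
    unfolding cong_minus_minus_iff by (rule functional_mult[OF functional_comm_left[OF f f0 x] ab])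
  also have "- (f (comm a x) + f (comm b x)) = (- f (comm a x)) + (- f (comm b x))" by simp
  also have "[(- f (comm a x)) + (- f (comm b x)) = f (comm x a) + f (comm x b)] (mod int p)"
    by (intro cong_add cong_sym[OF functional_comm_swap[OF f]] ab x)
  finally show "[f (comm x (a \<otimes> b)) = f (comm x a) + f (comm x b)] (mod int p)" .
qed

text \<open>The functionals of a dual basis of \<open>\<gamma>\<^sub>2 / \<gamma>\<^sub>3\<close>,
  applied to commutators, give \<open>n\<close> alternating forms on
  \<open>G / \<gamma>\<^sub>2\<close>. Surjectivity of commutation with an element outside
  \<open>\<gamma>\<^sub>2\<close> makes their pencil nondegenerate.\<close>

lemma rank_bound:
  assumes dx: "dual_system p (carrier G) \<gamma>\<^sub>2 m x \<mu>" and dw: "dual_system p \<gamma>\<^sub>2 \<gamma>\<^sub>3 n w \<nu>"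
  shows "2 * n \<le> m"
proof -
  \<comment> \<open>Only entries with \<open>i < j\<close> are read off directly: the values of
    \<open>\<nu> k\<close> on commutators are antisymmetric merely modulo \<open>p\<close>, while
    \<open>alternating_forms\<close> asks for equalities.\<close>
  define B where "B k i j = (if i < j then \<nu> k (comm (x i) (x j))
    else if j < i then - \<nu> k (comm (x j) (x i)) else 0)" for k i j
  have p1: "p > 1" using prime_gt_1_nat[OF prime] .
  have xG: "x i \<in> carrier G" if "i < m" for i by (rule dual_systemD(1)[OF dx that])
  have \<nu>: "functional p \<gamma>\<^sub>2 (\<nu> k)" if "k < n" for k by (rule dual_systemD(2)[OF dw that])
  have \<nu>0: "int p dvd \<nu> k z" if "z \<in> \<gamma>\<^sub>3" "k < n" for k z
    using dual_systemD(4)[OF dw, of z] that by blast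
  have B: "[B k i j = \<nu> k (comm (x i) (x j))] (mod int p)" if "k < n" "i < m" "j < m" for k i j
  proof -
    consider "i < j" | "j < i" | "i = j" by linarith
    then show ?thesis
    proof cases
      case 1
      then show ?thesis by (simp add: B_def)
    next
      case 2
      then show ?thesis
        using cong_sym[OF functional_comm_swap[OF \<nu>[OF that(1)] xG[OF that(2)] xG[OF that(3)]]]
        by (simp add: B_def)
    next
      case 3
      then show ?thesis
        using cong_sym[OF functional_one[OF \<nu>[OF that(1)] \<gamma>2_subgroup]] xG[OF that(2)]
        by (simp add: B_def commutator_self)
    qed
  qed
  have alt: "alternating_forms m B" by (simp add: alternating_forms_def B_def)
  have m: "m > 0"
  proof (rule ccontr)
    assume "\<not> m > 0"
    then have "\<gamma>\<^sub>2 = carrier G" using dual_systemD(4)[OF dx] by blast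
    then show False using \<gamma>2_neq_carrier by blast
  qed
  have "nondegenerate_pencil p m n B"
    unfolding nondegenerate_pencil_def nondegenerate_mod_def
  proof (intro allI impI)
    fix \<phi> a :: "nat \<Rightarrow> int"
    assume "\<exists>k<n. \<not> int p dvd \<phi> k" "\<exists>i<m. \<not> int p dvd a i"
    then obtain k i where k: "k < n" "\<not> int p dvd \<phi> k" and i: "i < m" "\<not> int p dvd a i" by blast
    define f where "f g = (\<Sum>k<n. \<phi> k * \<nu> k g)" for g
    have f: "functional p \<gamma>\<^sub>2 f"
      unfolding f_def by (intro functional_sum functional_scale \<nu>) simp
    have f0: "int p dvd f z" if "z \<in> \<gamma>\<^sub>3" for z
      unfolding f_def using \<nu>0 that by (intro dvd_sum) simp
    have fB: "[f (comm (x i) (x j)) = form_comb n B \<phi> i j] (mod int p)" if "i < m" "j < m" for i j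
      unfolding f_def form_comb_def
      using that by (intro cong_sum cong_mult cong_refl cong_sym[OF B]) auto
    have "[f (w k) = (\<Sum>l<n. \<phi> l * (if l = k then 1 else 0))] (mod int p)"
      unfolding f_def using k by (intro cong_sum cong_mult cong_refl dual_systemD(3)[OF dw]) auto
    also have "(\<Sum>l<n. \<phi> l * (if l = k then 1 else 0)) = \<phi> k"
      using k by (simp add: if_distrib[of "\<lambda>t. _ * t"] cong: if_cong)
    finally have fw: "\<not> int p dvd f (w k)" using k cong_dvd_iff by blast
    define e where "e i = nat (a i mod int p)" for i
    have e: "[int (e i) = a i] (mod int p)" for i using p1 by (simp add: e_def)
    define s where "s = word x e m"
    have s: "s \<in> carrier G" unfolding s_def by (rule word_mem[OF subgroup_self xG])
    have val: "[h s = (\<Sum>i<m. a i * h (x i))] (mod int p)" if "functional p (carrier G) h" for h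
    proof -
      have "[h s = (\<Sum>i<m. int (e i) * h (x i))] (mod int p)"
        unfolding s_def by (rule functional_word[OF that subgroup_self xG])
      also have "[(\<Sum>i<m. int (e i) * h (x i)) = (\<Sum>i<m. a i * h (x i))] (mod int p)"
        by (intro cong_sum cong_mult cong_refl e)
      finally show ?thesis .
    qed
    have "[\<mu> i s = (\<Sum>l<m. a l * \<mu> i (x l))] (mod int p)"
      by (rule val[OF dual_systemD(2)[OF dx i(1)]])
    also have "[(\<Sum>l<m. a l * \<mu> i (x l)) = (\<Sum>l<m. a l * (if i = l then 1 else 0))] (mod int p)"
      using i by (intro cong_sum cong_mult cong_refl dual_systemD(3)[OF dx]) auto
    also have "(\<Sum>l<m. a l * (if i = l then 1 else 0)) = a i"
      using i by (simp add: if_distrib[of "\<lambda>t. _ * t"] cong: if_cong)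
    finally have "\<not> int p dvd \<mu> i s" using i cong_dvd_iff by blast
    then have "s \<notin> \<gamma>\<^sub>2" using i dual_systemD(4)[OF dx, of s] by blast
    \<comment> \<open>The target \<open>w k\<close> is chosen because \<open>f (w k)\<close> is
      congruent to \<open>\<phi> k\<close>, which is nonzero modulo \<open>p\<close>.\<close>
    then obtain t where t: "t \<in> carrier G" "comm s t = w k"
      using comm_surj_\<gamma>2[OF s] dual_systemD(1)[OF dw k(1)] by blast
    show "\<exists>j<m. \<not> int p dvd (\<Sum>i<m. a i * form_comb n B \<phi> i j)"
    proof (rule ccontr)
      assume "\<not> ?thesis"
      then have *: "int p dvd (\<Sum>i<m. a i * form_comb n B \<phi> i j)" if "j < m" for j using that by blast
      \<comment> \<open>If \<open>a\<close> were in the radical, the functional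
        \<open>f [s, -]\<close> would vanish on the basis \<open>x\<close>, hence on all of
        \<open>G\<close>.\<close>
      have "int p dvd f (comm s t)"
      proof (rule functional_vanishes[OF prime subgroup_self dx functional_comm_right[OF f f0 s] _ _ t(1)])
        fix j assume j: "j < m"
        have "[f (comm s (x j)) = (\<Sum>i<m. a i * f (comm (x i) (x j)))] (mod int p)"
          by (rule val[OF functional_comm_left[OF f f0 xG[OF j]]])
        also have "[(\<Sum>i<m. a i * f (comm (x i) (x j))) = (\<Sum>i<m. a i * form_comb n B \<phi> i j)] (mod int p)"
          using j by (intro cong_sum cong_mult cong_refl fB) auto
        finally show "int p dvd f (comm s (x j))" using *[OF j] cong_dvd_iff by blast
      qed (simp_all add: f0 comm_mem_\<gamma>3' s)
      with t fw show False by simp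
    qed
  qed
  with nondegenerate_pencil_bound[OF prime m alt] show ?thesis by blast
qed

text \<open>This is the rank bound as an inequality of indices, \<open>|\<gamma>\<^sub>2 :
  \<gamma>\<^sub>3|^2 \<le> |G : \<gamma>\<^sub>2|\<close>, cleared of denominators.\<close>

lemma card_\<gamma>2_bound: "card \<gamma>\<^sub>2 ^ 3 \<le> card (carrier G) * card \<gamma>\<^sub>3 ^ 2"
proof -
  obtain m x \<mu> where dx: "dual_system p (carrier G) \<gamma>\<^sub>2 m x \<mu>"
    using dual_system_exists[OF fin prime elementary_carrier[OF \<gamma>2_subgroup]] by blast
  obtain n w \<nu> where dw: "dual_system p \<gamma>\<^sub>2 \<gamma>\<^sub>3 n w \<nu>"
    using dual_system_exists[OF fin prime elementary_\<gamma>2[OF \<gamma>3_subgroup _ \<gamma>3_sub]] by blast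
  have G: "card (carrier G) = p ^ m * card \<gamma>\<^sub>2" by (rule card_dual_system[OF fin prime subgroup_self dx])
  have g2: "card \<gamma>\<^sub>2 = p ^ n * card \<gamma>\<^sub>3" by (rule card_dual_system[OF fin prime \<gamma>2_subgroup dw])
  have "p ^ (2 * n) \<le> p ^ m"
    using rank_bound[OF dx dw] prime_gt_0_nat[OF prime] by (intro power_increasing) auto
  then have "p ^ (2 * n) * (card \<gamma>\<^sub>2 * card \<gamma>\<^sub>3 ^ 2) \<le> p ^ m * (card \<gamma>\<^sub>2 * card \<gamma>\<^sub>3 ^ 2)" by (rule mult_le_mono1)
  moreover have "card \<gamma>\<^sub>2 ^ 3 = card \<gamma>\<^sub>2 * (p ^ n * card \<gamma>\<^sub>3) ^ 2"
    by (subst g2[symmetric]) (simp add: power3_eq_cube power2_eq_square)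
  ultimately show ?thesis unfolding G
    by (simp add: power_mult_distrib power_mult[symmetric] mult_ac)
qed

text \<open>A form of the Hall-Witt identity. Conjugation by \<open>z\<close> turns \<open>d\<close>
  and \<open>e\<close> into \<open>d [d, z]\<close> and \<open>e [e, z]\<close>; the expansion
  collapses because \<open>\<gamma>\<^sub>2\<close> is abelian and \<open>\<gamma>\<^sub>3\<close>
  central.\<close>

lemma comm_centralized_mod:
  assumes "d \<in> carrier G" "e \<in> carrier G" "z \<in> carrier G"
  shows "comm (comm d e) z = inv (comm (comm e z) d) \<otimes> comm (comm d z) e"
proof -
  let ?u = "comm d z" and ?v = "comm e z" and ?c = "comm d e"
  have mem: "?u \<in> \<gamma>\<^sub>2" "?v \<in> \<gamma>\<^sub>2" "?c \<in> \<gamma>\<^sub>2" using assms comm_mem_\<gamma>2 by auto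
  have cl: "?u \<in> carrier G" "?v \<in> carrier G" "?c \<in> carrier G" using assms by auto
  have dv: "comm d ?v \<in> \<gamma>\<^sub>3" by (rule comm_mem_\<gamma>3'[OF assms(1) mem(2)])
  have "inv z \<otimes> ?c \<otimes> z = comm (inv z \<otimes> d \<otimes> z) (inv z \<otimes> e \<otimes> z)"
    using assms by (simp add: commutator_def m_assoc mult_inv_cancel inv_mult_cancel inv_mult_group)
  also have "\<dots> = comm (d \<otimes> ?u) (e \<otimes> ?v)"
    using assms by (simp add: conj_eq_mult_commutator)
  also have "\<dots> = comm d (e \<otimes> ?v) \<otimes> comm (comm d (e \<otimes> ?v)) ?u \<otimes> comm ?u (e \<otimes> ?v)"
    using assms cl by (intro commutator_mult_left) auto
  also have "comm (comm d (e \<otimes> ?v)) ?u = \<one>"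
    using assms cl by (intro \<gamma>2_abelian mem comm_mem_\<gamma>2) auto
  also have "comm ?u (e \<otimes> ?v) = comm ?u e"
    using assms cl mem by (simp add: comm_\<gamma>2_mult_right \<gamma>2_abelian)
  also have "comm d (e \<otimes> ?v) = comm d ?v \<otimes> ?c"
    using assms cl mem by (simp add: commutator_mult_right \<gamma>2_abelian)
  also have "comm d ?v \<otimes> ?c = ?c \<otimes> comm d ?v" by (rule \<gamma>3_central[OF dv cl(3)])
  finally have "?c \<otimes> comm ?c z = ?c \<otimes> (comm d ?v \<otimes> comm ?u e)"
    unfolding conj_eq_mult_commutator[OF cl(3) assms(3)] using assms cl by (simp add: m_assoc)
  then have "comm ?c z = comm d ?v \<otimes> comm ?u e" using assms cl by simp
  then show ?thesis using assms cl by (simp add: commutator_inv)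
qed

lemma comm_surj_\<gamma>3:
  assumes w: "w \<in> \<gamma>\<^sub>2" "w \<notin> \<gamma>\<^sub>3" and z: "z \<in> \<gamma>\<^sub>3"
  shows "\<exists>y\<in>carrier G. comm w y = z"
proof (rule ccontr)
  assume no: "\<not> ?thesis"
  let ?R = "(\<lambda>y. comm w y) ` carrier G"
  have wc: "w \<in> carrier G" by (rule \<gamma>2_carrier[OF w(1)])
  \<comment> \<open>Commutation with \<open>w\<close> is a homomorphism, so its image is a subgroup
    and can be killed by a functional.\<close>
  have R: "subgroup ?R G"
  proof
    show "?R \<subseteq> carrier G" using wc by auto
    show "\<one> \<in> ?R" using wc by (intro image_eqI[of _ _ \<one>]) (simp_all add: commutator_def)
    fix s t assume "s \<in> ?R" "t \<in> ?R"
    then obtain a b where ab: "a \<in> carrier G" "b \<in> carrier G" "s = comm w a" "t = comm w b" by blast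
    then show "s \<otimes> t \<in> ?R"
      by (intro image_eqI[of _ _ "a \<otimes> b"]) (simp_all add: comm_\<gamma>2_mult_right w)
    have "comm w (a \<otimes> inv a) = comm w a \<otimes> comm w (inv a)"
      using ab by (intro comm_\<gamma>2_mult_right w) auto
    then have "s \<otimes> comm w (inv a) = \<one>" using ab wc by (simp add: commutator_def)
    then have "inv s = comm w (inv a)" using ab wc
      by (metis commutator_closed inv_closed inv_comm inv_equality)
    then show "inv s \<in> ?R" using ab by (intro image_eqI[of _ _ "inv a"]) simp_all
  qed
  have R3: "?R \<subseteq> \<gamma>\<^sub>3" using comm_mem_\<gamma>3[OF w(1)] by blast
  obtain \<zeta> where \<zeta>: "functional p \<gamma>\<^sub>3 \<zeta>" and \<zeta>R: "\<forall>g\<in>?R. int p dvd \<zeta> g" and \<zeta>z: "[\<zeta> z = 1] (mod int p)"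
    using exists_functional[OF fin prime elementary_\<gamma>3[OF R R3] z] no by blast
  have not1: "\<not> int p dvd 1" using prime_gt_1_nat[OF prime] by simp
  \<comment> \<open>\<open>U\<close> and \<open>D\<close> are the left and right radicals of the
    pairing \<open>\<zeta> [u, y]\<close> between \<open>\<gamma>\<^sub>2\<close> and
    \<open>G\<close>. By the choice of \<open>\<zeta>\<close>, \<open>w\<close> is in
    \<open>U\<close>.\<close>
  define U where "U = {u \<in> \<gamma>\<^sub>2. \<forall>y\<in>carrier G. int p dvd \<zeta> (comm u y)}"
  define D where "D = {y \<in> carrier G. \<forall>u\<in>\<gamma>\<^sub>2. int p dvd \<zeta> (comm u y)}"
  have fL: "functional p \<gamma>\<^sub>2 (\<lambda>u. \<zeta> (comm u y))" if "y \<in> carrier G" for y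
    unfolding functional_def
    by (intro ballI) (simp add: that comm_\<gamma>2_mult_left functional_mult[OF \<zeta>] comm_mem_\<gamma>3)
  have fR: "functional p (carrier G) (\<lambda>y. \<zeta> (comm u y))" if "u \<in> \<gamma>\<^sub>2" for u
    unfolding functional_def
    by (intro ballI) (simp add: that comm_\<gamma>2_mult_right functional_mult[OF \<zeta>] comm_mem_\<gamma>3)
  have \<zeta>1: "int p dvd \<zeta> \<one>" using functional_one[OF \<zeta> \<gamma>3_subgroup] by (simp add: cong_0_iff)
  have U: "subgroup U G"
  proof
    show "U \<subseteq> carrier G" using \<gamma>2_carrier by (auto simp: U_def)
    show "\<one> \<in> U" using subgroup.one_closed[OF \<gamma>2_subgroup] \<zeta>1 by (simp add: U_def commutator_def)
    fix s t assume st: "s \<in> U" "t \<in> U"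
    then have s: "s \<in> \<gamma>\<^sub>2" "t \<in> \<gamma>\<^sub>2" by (auto simp: U_def)
    have "int p dvd \<zeta> (comm (s \<otimes> t) y)" if y: "y \<in> carrier G" for y
      using cong_dvd_iff[OF functional_mult[OF fL[OF y] s]] st y by (simp add: U_def)
    then show "s \<otimes> t \<in> U" using s subgroup.m_closed[OF \<gamma>2_subgroup] by (simp add: U_def)
    have "int p dvd \<zeta> (comm (inv s) y)" if y: "y \<in> carrier G" for y
      using cong_dvd_iff[OF functional_inv[OF fL[OF y] \<gamma>2_subgroup s(1)]] st y by (simp add: U_def)
    then show "inv s \<in> U" using s subgroup.m_inv_closed[OF \<gamma>2_subgroup] by (simp add: U_def)
  qed
  have D: "subgroup D G"
  proof
    show "D \<subseteq> carrier G" by (auto simp: D_def)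
    show "\<one> \<in> D" using \<zeta>1 \<gamma>2_carrier by (simp add: D_def commutator_def)
    fix s t assume st: "s \<in> D" "t \<in> D"
    then have s: "s \<in> carrier G" "t \<in> carrier G" by (auto simp: D_def)
    have "int p dvd \<zeta> (comm u (s \<otimes> t))" if u: "u \<in> \<gamma>\<^sub>2" for u
      using cong_dvd_iff[OF functional_mult[OF fR[OF u] s]] st u by (simp add: D_def)
    then show "s \<otimes> t \<in> D" using s by (simp add: D_def)
    have "int p dvd \<zeta> (comm u (inv s))" if u: "u \<in> \<gamma>\<^sub>2" for u
      using cong_dvd_iff[OF functional_inv[OF fR[OF u] subgroup_self s(1)]] st u by (simp add: D_def)
    then show "inv s \<in> D" using s by (simp add: D_def)
  qed
  have U3: "\<gamma>\<^sub>3 \<subseteq> U" using \<gamma>3_sub \<zeta>1 comm_\<gamma>3 by (auto simp: U_def)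
  have U2: "U \<subseteq> \<gamma>\<^sub>2" by (auto simp: U_def)
  have wU: "w \<in> U" using w \<zeta>R by (auto simp: U_def)
  have D2: "\<gamma>\<^sub>2 \<subseteq> D" using \<gamma>2_abelian \<gamma>2_carrier \<zeta>1 by (auto simp: D_def)
  have eU: "elementary_pair p \<gamma>\<^sub>2 U" by (rule elementary_\<gamma>2[OF U U3 U2])
  have eD: "elementary_pair p (carrier G) D" by (rule elementary_carrier[OF D D2])
  have finD: "finite D" and fin2: "finite \<gamma>\<^sub>2"
    using fin D \<gamma>2_subgroup by (meson finite_subset subgroup.subset)+
  \<comment> \<open>An element of \<open>G\<close> is determined modulo \<open>D\<close> by the
    functional it induces on \<open>\<gamma>\<^sub>2 / U\<close>.\<close>
  have c1: "card (carrier G) * card U \<le> card \<gamma>\<^sub>2 * card D"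
  proof (rule card_pairing_le[OF fin prime subgroup_self eU, of "\<lambda>y u. \<zeta> (comm u y)"])
    show "\<And>y. y \<in> carrier G \<Longrightarrow> functional p \<gamma>\<^sub>2 (\<lambda>u. \<zeta> (comm u y))" by (rule fL)
    show "\<And>u. u \<in> \<gamma>\<^sub>2 \<Longrightarrow> functional p (carrier G) (\<lambda>y. \<zeta> (comm u y))" by (rule fR)
  qed (auto simp: U_def D_def finD[unfolded D_def])
  \<comment> \<open>Otherwise \<open>\<zeta>\<close> would kill all generators of
    \<open>\<gamma>\<^sub>3\<close>, and so \<open>z\<close>.\<close>
  have "U \<noteq> \<gamma>\<^sub>2"
  proof
    assume "U = \<gamma>\<^sub>2"
    then have gen: "int p dvd \<zeta> (comm u y)" if "u \<in> \<gamma>\<^sub>2" "y \<in> carrier G" for u y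
      using that by (auto simp: U_def)
    have sub: "generate G {comm u y | u y. u \<in> \<gamma>\<^sub>2 \<and> y \<in> carrier G} \<subseteq> \<gamma>\<^sub>3"
      using \<gamma>3_generate by simp
    have "int p dvd \<zeta> z" using z unfolding \<gamma>3_generate
    proof induction
      case one
      show ?case by (rule \<zeta>1)
    next
      case (incl h)
      then show ?case using gen by blast
    next
      case (inv h)
      then obtain u y where h: "u \<in> \<gamma>\<^sub>2" "y \<in> carrier G" "h = comm u y" by blast
      then show ?case
        using cong_dvd_iff[OF functional_inv[OF \<zeta> \<gamma>3_subgroup comm_mem_\<gamma>3[OF h(1,2)]]] gen by simp
    next
      case (eng g h)
      then have "g \<in> \<gamma>\<^sub>3" "h \<in> \<gamma>\<^sub>3" using sub by auto
      then show ?case using cong_dvd_iff[OF functional_mult[OF \<zeta>]] eng by simp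
    qed
    then show False using cong_dvd_iff[OF \<zeta>z] not1 by simp
  qed
  then obtain a where a: "a \<in> \<gamma>\<^sub>2" "a \<notin> U" using U2 by blast
  \<comment> \<open>As \<open>\<gamma>\<^sub>3 \<le> U\<close>, the functional \<open>\<phi>\<close>
    induces a bilinear form \<open>\<phi> [x, y]\<close> on
    \<open>G / \<gamma>\<^sub>2\<close>.\<close>
  obtain \<phi> where \<phi>: "functional p \<gamma>\<^sub>2 \<phi>" and \<phi>U: "\<forall>g\<in>U. int p dvd \<phi> g" and \<phi>a: "[\<phi> a = 1] (mod int p)"
    using exists_functional[OF fin prime eU a] by blast
  have \<phi>3: "int p dvd \<phi> z" if "z \<in> \<gamma>\<^sub>3" for z using that U3 \<phi>U by blast
  \<comment> \<open>The Hall-Witt identity rewrites \<open>[[d, e], z]\<close> through commutators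
    of elements of \<open>\<gamma>\<^sub>2\<close> with \<open>d\<close> and \<open>e\<close>, which
    \<open>\<zeta>\<close> kills by definition of \<open>D\<close>.\<close>
  have DD: "comm d e \<in> U" if d: "d \<in> D" and e: "e \<in> D" for d e
  proof -
    have cl: "d \<in> carrier G" "e \<in> carrier G" using d e by (auto simp: D_def)
    have "int p dvd \<zeta> (comm (comm d e) z)" if z: "z \<in> carrier G" for z
    proof -
      have m: "comm e z \<in> \<gamma>\<^sub>2" "comm d z \<in> \<gamma>\<^sub>2" using cl z comm_mem_\<gamma>2 by auto
      have "[\<zeta> (comm (comm d e) z) = \<zeta> (inv (comm (comm e z) d)) + \<zeta> (comm (comm d z) e)] (mod int p)"
        unfolding comm_centralized_mod[OF cl z]
        by (rule functional_mult[OF \<zeta> subgroup.m_inv_closed[OF \<gamma>3_subgroup]]) (intro comm_mem_\<gamma>3 m cl)+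
      moreover have "int p dvd \<zeta> (inv (comm (comm e z) d))"
        using cong_dvd_iff[OF functional_inv[OF \<zeta> \<gamma>3_subgroup comm_mem_\<gamma>3[OF m(1) cl(1)]]] d m by (simp add: D_def)
      moreover have "int p dvd \<zeta> (comm (comm d z) e)" using e m by (simp add: D_def)
      ultimately show ?thesis using cong_dvd_iff dvd_add by blast
    qed
    then show ?thesis using comm_mem_\<gamma>2[OF cl] by (simp add: U_def)
  qed
  have Dc: "D \<subseteq> carrier G" by (rule subgroup.subset[OF D])
  \<comment> \<open>The form pairs \<open>D\<close> with \<open>G\<close>. It vanishes on
    \<open>D\<close> in the second argument, by the preceding isotropy, and its left kernel is
    inside \<open>\<gamma>\<^sub>2\<close>: for \<open>d\<close> outside, some \<open>[d, y]\<close>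
    equals \<open>a\<close>.\<close>
  have c2: "card D * card D \<le> card (carrier G) * card \<gamma>\<^sub>2"
  proof (rule card_pairing_le[OF fin prime D eD, of "\<lambda>d g. \<phi> (comm d g)"])
    fix d assume d: "d \<in> D"
    then have dc: "d \<in> carrier G" using Dc by blast
    then show "functional p (carrier G) (\<lambda>g. \<phi> (comm d g))" by (intro functional_comm_right \<phi> \<phi>3)
    show "int p dvd \<phi> (comm d b)" if "b \<in> D" for b using DD[OF d that] \<phi>U by blast
    assume all: "\<And>b. b \<in> carrier G \<Longrightarrow> int p dvd \<phi> (comm d b)"
    show "d \<in> \<gamma>\<^sub>2"
    proof (rule ccontr)
      assume "d \<notin> \<gamma>\<^sub>2"
      then obtain y where "y \<in> carrier G" "comm d y = a" using comm_surj_\<gamma>2[OF dc _ a(1)] by blast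
      then show False using all[of y] cong_dvd_iff[OF \<phi>a] not1 by simp
    qed
  next
    fix b assume "b \<in> carrier G"
    then show "functional p D (\<lambda>d. \<phi> (comm d b))"
      by (intro functional_subset[OF _ Dc] functional_comm_left \<phi> \<phi>3)
  qed (rule fin2)
  have lt: "card \<gamma>\<^sub>3 < card U"
    using U3 wU w finite_subset[OF U2 fin2] by (intro psubset_card_mono) auto
  have pos: "card (carrier G) > 0" "card \<gamma>\<^sub>2 > 0" "card D > 0"
    using fin fin2 finD subgroup.one_closed[OF \<gamma>2_subgroup] subgroup.one_closed[OF D]
    by (auto simp: card_gt_0_iff)
  \<comment> \<open>The two pairing inequalities and the index bound combine to
    \<open>|U| \<le> |\<gamma>\<^sub>3|\<close>, while \<open>w\<close> makes \<open>U\<close>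
    strictly larger.\<close>
  have "(card (carrier G) * card U) ^ 2 \<le> (card \<gamma>\<^sub>2 * card D) ^ 2" using c1 by (intro power_mono) auto
  also have "\<dots> = card \<gamma>\<^sub>2 ^ 2 * (card D * card D)" by (simp add: power2_eq_square mult_ac)
  also have "\<dots> \<le> card \<gamma>\<^sub>2 ^ 2 * (card (carrier G) * card \<gamma>\<^sub>2)" using c2 by (rule mult_le_mono2)
  also have "\<dots> = card (carrier G) * card \<gamma>\<^sub>2 ^ 3" by (simp add: power2_eq_square power3_eq_cube)
  also have "\<dots> \<le> card (carrier G) * (card (carrier G) * card \<gamma>\<^sub>3 ^ 2)"
    using card_\<gamma>2_bound by (rule mult_le_mono2)
  finally have "card (carrier G) ^ 2 * card U ^ 2 \<le> card (carrier G) ^ 2 * card \<gamma>\<^sub>3 ^ 2"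
    by (simp add: power2_eq_square mult_ac)
  then have "card U ^ 2 \<le> card \<gamma>\<^sub>3 ^ 2" using pos(1) by simp
  then show False using lt power_mono_iff[of "card U" "card \<gamma>\<^sub>3" 2] by simp
qed

section \<open>Counting solutions of commutator equations\<close>

lemma card_comm_fibre:
  assumes x: "x \<in> carrier G" and g: "g \<in> comm x ` carrier G"
  shows "card {y \<in> carrier G. comm x y = g} * card (comm x ` carrier G) = card (carrier G)"
proof -
  let ?C = "{y \<in> carrier G. comm x y = \<one>}"
  have fibre: "card {y \<in> carrier G. comm x y = h} = card ?C" if h: "h \<in> comm x ` carrier G" for h
  proof -
    obtain b where b: "b \<in> carrier G" "h = comm x b" using h by blast
    \<comment> \<open>Since \<open>[x, c b]\<close> is \<open>[x, b]\<close> times the conjugate of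
      \<open>[x, c]\<close> by \<open>b\<close>, the fibre over \<open>[x, b]\<close> is the
      translate by \<open>b\<close> of the centralizer of \<open>x\<close>.\<close>
    have shift: "comm x (c \<otimes> b) = comm x b \<longleftrightarrow> comm x c = \<one>" if c: "c \<in> carrier G" for c
    proof -
      have "comm x (c \<otimes> b) = comm x b \<otimes> (inv b \<otimes> comm x c \<otimes> b)"
        using x b c by (simp add: commutator_mult_right m_assoc conj_eq_mult_commutator[symmetric])
      then have "comm x (c \<otimes> b) = comm x b \<longleftrightarrow> inv b \<otimes> comm x c \<otimes> b = \<one>"
        using x b c by simp
      also have "\<dots> \<longleftrightarrow> comm x c = \<one>"
      proof
        assume "inv b \<otimes> comm x c \<otimes> b = \<one>"
        then have "b \<otimes> (inv b \<otimes> comm x c \<otimes> b) \<otimes> inv b = \<one>" using b by simp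
        then show "comm x c = \<one>" using x b c by (simp add: m_assoc mult_inv_cancel)
      qed (use b in simp)
      finally show ?thesis .
    qed
    have "bij_betw (\<lambda>c. c \<otimes> b) ?C {y \<in> carrier G. comm x y = h}"
    proof (rule bij_betw_byWitness[of _ "\<lambda>y. y \<otimes> inv b"])
      show "(\<lambda>y. y \<otimes> inv b) ` {y \<in> carrier G. comm x y = h} \<subseteq> ?C"
      proof safe
        fix y assume y: "y \<in> carrier G" "h = comm x y"
        then show "y \<otimes> inv b \<in> carrier G" using b by simp
        have "y \<otimes> inv b \<otimes> b = y" using y b by (simp add: m_assoc)
        then show "comm x (y \<otimes> inv b) = \<one>" using shift[of "y \<otimes> inv b"] y b by simp
      qed
    qed (use b shift in \<open>auto simp: m_assoc\<close>)
    then show ?thesis by (simp add: bij_betw_same_card)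
  qed
  have "card (carrier G) = (\<Sum>h\<in>comm x ` carrier G. card {y \<in> carrier G. comm x y = h})"
    by (rule card_eq_sum_fibres) (use fin in auto)
  also have "\<dots> = (\<Sum>h\<in>comm x ` carrier G. card ?C)" by (intro sum.cong refl fibre)
  finally show ?thesis using fibre[OF g] by simp
qed

lemma comm_image_outside:
  assumes "x \<in> carrier G - \<gamma>\<^sub>2"
  shows "comm x ` carrier G = \<gamma>\<^sub>2"
  using assms comm_mem_\<gamma>2 comm_surj_\<gamma>2[of x] by blast

lemma comm_image_\<gamma>2:
  assumes "x \<in> \<gamma>\<^sub>2 - \<gamma>\<^sub>3"
  shows "comm x ` carrier G = \<gamma>\<^sub>3"
  using assms comm_mem_\<gamma>3 comm_surj_\<gamma>3[of x] by blast

text \<open>A single \<open>x\<close> outside \<open>\<gamma>\<^sub>2\<close> already produces all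
  of \<open>\<gamma>\<^sub>2\<close> as commutators \<open>[x, y]\<close>.\<close>

lemma commutators_eq_\<gamma>2: "commutators G = \<gamma>\<^sub>2"
proof
  show "commutators G \<subseteq> \<gamma>\<^sub>2" using comm_mem_\<gamma>2 by (auto simp: commutators_def)
  obtain x where "x \<in> carrier G" "x \<notin> \<gamma>\<^sub>2" by (rule obtain_outside)
  then show "\<gamma>\<^sub>2 \<subseteq> commutators G" using comm_surj_\<gamma>2 unfolding commutators_def by blast
qed

text \<open>Sum over \<open>x\<close> by layers: \<open>[x, G]\<close> is
  \<open>\<gamma>\<^sub>2\<close>, \<open>\<gamma>\<^sub>3\<close> or 1 according to the layer of
  \<open>x\<close>, and each of its elements has \<open>|G| / |[x, G]|\<close> solutions
  \<open>y\<close>. As \<open>g \<noteq> \<one>\<close>, the layer \<open>\<gamma>\<^sub>3\<close>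
  contributes nothing.\<close>

lemma commutator_prob_eq:
  assumes g: "g \<in> \<gamma>\<^sub>2" "g \<noteq> \<one>"
  shows "commutator_prob G g = 1 / real (card (carrier G)) *
    (real (card (carrier G - \<gamma>\<^sub>2)) / real (card \<gamma>\<^sub>2) +
      (if g \<in> \<gamma>\<^sub>3 then real (card (\<gamma>\<^sub>2 - \<gamma>\<^sub>3)) / real (card \<gamma>\<^sub>3) else 0))"
proof -
  let ?F = "\<lambda>x. card {y \<in> carrier G. comm x y = g}"
  let ?n = "real (card (carrier G))"
  have fin2: "finite \<gamma>\<^sub>2" and fin3: "finite \<gamma>\<^sub>3"
    using fin \<gamma>2_subgroup \<gamma>3_subgroup by (meson finite_subset subgroup.subset)+
  have pos: "card \<gamma>\<^sub>2 > 0" "card \<gamma>\<^sub>3 > 0" "card (carrier G) > 0"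
    using fin fin2 fin3 subgroup.one_closed[OF \<gamma>2_subgroup] subgroup.one_closed[OF \<gamma>3_subgroup]
    by (auto simp: card_gt_0_iff)
  have outside: "real (?F x) = ?n / real (card \<gamma>\<^sub>2)" if x: "x \<in> carrier G - \<gamma>\<^sub>2" for x
  proof -
    have "?F x * card \<gamma>\<^sub>2 = card (carrier G)"
      using card_comm_fibre[of x g] x g comm_image_outside[OF x] by simp
    then have "real (?F x) * real (card \<gamma>\<^sub>2) = ?n" by (metis of_nat_mult)
    then show ?thesis using pos by (simp add: field_simps)
  qed
  have middle: "real (?F x) = (if g \<in> \<gamma>\<^sub>3 then ?n / real (card \<gamma>\<^sub>3) else 0)" if x: "x \<in> \<gamma>\<^sub>2 - \<gamma>\<^sub>3" for x
  proof (cases "g \<in> \<gamma>\<^sub>3")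
    case True
    then have "?F x * card \<gamma>\<^sub>3 = card (carrier G)"
      using card_comm_fibre[of x g] x \<gamma>2_carrier comm_image_\<gamma>2[OF x] by simp
    then have "real (?F x) * real (card \<gamma>\<^sub>3) = ?n" by (metis of_nat_mult)
    then show ?thesis using pos True by (simp add: field_simps)
  next
    case False
    then have "{y \<in> carrier G. comm x y = g} = {}" using comm_image_\<gamma>2[OF x] by blast
    then show ?thesis using False by (simp only: card.empty) simp
  qed
  have inside: "real (?F x) = 0" if "x \<in> \<gamma>\<^sub>3" for x
  proof -
    have "{y \<in> carrier G. comm x y = g} = {}" using comm_\<gamma>3[OF that] g by auto
    then show ?thesis by (simp only: card.empty)
  qed
  have "{(x, y). x \<in> carrier G \<and> y \<in> carrier G \<and> comm x y = g} =
      (SIGMA x:carrier G. {y \<in> carrier G. comm x y = g})" by auto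
  then have "real (card {(x, y). x \<in> carrier G \<and> y \<in> carrier G \<and> comm x y = g}) =
      (\<Sum>x\<in>carrier G. real (?F x))"
    using fin by (simp add: card_SigmaI)
  also have "\<dots> = (\<Sum>x\<in>carrier G - \<gamma>\<^sub>2. real (?F x)) + (\<Sum>x\<in>\<gamma>\<^sub>2. real (?F x))"
    using sum.subset_diff[OF subgroup.subset[OF \<gamma>2_subgroup] fin] .
  also have "(\<Sum>x\<in>\<gamma>\<^sub>2. real (?F x)) = (\<Sum>x\<in>\<gamma>\<^sub>2 - \<gamma>\<^sub>3. real (?F x)) + (\<Sum>x\<in>\<gamma>\<^sub>3. real (?F x))"
    using sum.subset_diff[OF \<gamma>3_sub fin2] .
  also have "(\<Sum>x\<in>carrier G - \<gamma>\<^sub>2. real (?F x)) = real (card (carrier G - \<gamma>\<^sub>2)) * (?n / real (card \<gamma>\<^sub>2))"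
    using outside by simp
  also have "(\<Sum>x\<in>\<gamma>\<^sub>2 - \<gamma>\<^sub>3. real (?F x)) =
      real (card (\<gamma>\<^sub>2 - \<gamma>\<^sub>3)) * (if g \<in> \<gamma>\<^sub>3 then ?n / real (card \<gamma>\<^sub>3) else 0)"
    using middle by (simp only: sum.cong[OF refl middle] sum_constant)
  also have "(\<Sum>x\<in>\<gamma>\<^sub>3. real (?F x)) = 0" by (rule sum.neutral) (use inside in blast)
  finally show ?thesis
    using pos by (auto simp: commutator_prob_def Coset.order_def power2_eq_square field_simps)
qed

text \<open>The value depends only on whether \<open>g\<close> lies in
  \<open>\<gamma>\<^sub>3\<close>. Both cases occur for nontrivial \<open>g\<close>, and they differ
  by a positive term because \<open>\<gamma>\<^sub>2 - \<gamma>\<^sub>3\<close> is nonempty.\<close>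

lemma card_commutator_probs: "card (commutator_probs G) = 2"
proof -
  obtain z where z: "z \<in> \<gamma>\<^sub>3" "z \<noteq> \<one>"
    using \<gamma>3_nontrivial subgroup.one_closed[OF \<gamma>3_subgroup] by blast
  obtain u where u: "u \<in> \<gamma>\<^sub>2" "u \<notin> \<gamma>\<^sub>3" using \<gamma>3_sub \<gamma>2_neq_\<gamma>3 by blast
  have u1: "u \<noteq> \<one>" using u subgroup.one_closed[OF \<gamma>3_subgroup] by blast
  have z2: "z \<in> \<gamma>\<^sub>2" using z \<gamma>3_sub by blast
  have eq: "commutator_prob G g = (if g \<in> \<gamma>\<^sub>3 then commutator_prob G z else commutator_prob G u)"
    if "g \<in> \<gamma>\<^sub>2" "g \<noteq> \<one>" for g
    using z u by (simp add: commutator_prob_eq that z2 u1)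
  have "commutator_probs G = {commutator_prob G z, commutator_prob G u}"
  proof
    show "commutator_probs G \<subseteq> {commutator_prob G z, commutator_prob G u}"
    proof
      fix t assume "t \<in> commutator_probs G"
      then obtain g where g: "g \<in> \<gamma>\<^sub>2" "g \<noteq> \<one>" "t = commutator_prob G g"
        unfolding commutator_probs_def commutators_eq_\<gamma>2 by blast
      then show "t \<in> {commutator_prob G z, commutator_prob G u}"
        unfolding g(3) by (subst eq[OF g(1,2)]) simp
    qed
    show "{commutator_prob G z, commutator_prob G u} \<subseteq> commutator_probs G"
      unfolding commutator_probs_def commutators_eq_\<gamma>2 using z z2 u u1 by blast
  qed
  moreover have "commutator_prob G z \<noteq> commutator_prob G u"
  proof -
    have "finite \<gamma>\<^sub>2" "finite \<gamma>\<^sub>3"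
      using fin \<gamma>2_subgroup \<gamma>3_subgroup by (meson finite_subset subgroup.subset)+
    then have "card (\<gamma>\<^sub>2 - \<gamma>\<^sub>3) > 0" "card \<gamma>\<^sub>3 > 0" "card (carrier G) > 0"
      using u z fin by (auto simp: card_gt_0_iff)
    then have "0 < 1 / real (card (carrier G)) * (real (card (\<gamma>\<^sub>2 - \<gamma>\<^sub>3)) / real (card \<gamma>\<^sub>3))"
      by (intro mult_pos_pos divide_pos_pos) auto
    then show ?thesis
      using u z by (simp only: commutator_prob_eq[OF z2 z(2)] commutator_prob_eq[OF u(1) u1]
        if_True if_False distrib_left add_0_right)
  qed
  ultimately show ?thesis by simp
qed

end

text \<open>The first formula is for nontrivial \<open>g\<close>, as in the definition of
  \<open>P(G)\<close>: for the identity, each \<open>x\<close> in \<open>\<gamma>\<^sub>3\<close>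
  would contribute a further \<open>|G|\<close> pairs.\<close>

theorem proposition5p14:
  fixes G :: "('a, 'b) monoid_scheme" and p :: nat
  assumes "Factorial_Ring.prime p"
    and "finite_p_group p G"
    and "camina_group G"
    and "nilpotent_of_class G 3"
  shows "(\<forall>g \<in> lower_central G 3. g \<noteq> \<one>\<^bsub>G\<^esub> \<longrightarrow>
            commutator_prob G g = 1 / real (order G) *
              (real (card (carrier G - lower_central G 2)) / real (card (lower_central G 2))
               + real (card (lower_central G 2 - lower_central G 3))
                   / real (card (lower_central G 3))))
       \<and> (\<forall>g \<in> lower_central G 2 - lower_central G 3.
            commutator_prob G g = 1 / real (order G) *
              (real (card (carrier G - lower_central G 2)) / real (card (lower_central G 2))))
       \<and> card (commutator_probs G) = 2"
proof -
  interpret group G using assms(2) by (simp add: finite_p_group_def)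
  interpret camina_p_group_class_3 G p by unfold_locales (fact assms)+
  have "g \<in> \<gamma>\<^sub>2" if "g \<in> \<gamma>\<^sub>3" for g using that \<gamma>3_sub by blast
  moreover have "g \<noteq> \<one>\<^bsub>G\<^esub>" if "g \<notin> \<gamma>\<^sub>3" for g
    using that subgroup.one_closed[OF \<gamma>3_subgroup] by blast
  ultimately show ?thesis
    using card_commutator_probs by (simp add: commutator_prob_eq Coset.order_def)
qed

end
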